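(* Let $A_0\in M_n^h(\mathbb{C})$ and, for $y\in\mathbb{R}^n$, let $A(y)=A_0+\mathrm{Diag}(y)$ and $$\bar A[y]=\begin{bmatrix}\Re(A_0)&-\Im(A_0)\\ \Im(A_0)&\Re(A_0)\end{bmatrix}+\begin{bmatrix}\mathrm{Diag}(y)&0\\0&\mathrm{Diag}(y)\end{bmatrix}\in\mathbb{R}^{2n\times2n}.$$ Let $x\in\mathbb{R}^n$. The following conditions are equivalent: (1) $x$ is a solution of $\min_{y\in\mathbb{R}^n}\max_{1\le i\le n}|\lambda_i(A(y))|$ (i.e. $A(x)$ is a minimal $n\times n$ matrix). (2) $\|\bar A[x]\|\le\|\bar A[y]\|$ for every $y\in\mathbb{R}^n$. (3) There is $w\ge0$ such that the largest eigenvalue of $\bar A[x]$ is $w$, with multiplicity $\bar t$, and the smallest eigenvalue of $\bar A[x]$ is $-w$, with multiplicity $\bar s$; and, for $\bar Q_1\in\mathbb{R}^{2n\times\bar t}$ and $\bar Q_2\in\mathbb{R}^{2n\times\bar s}$ whose columns are orthonormal bases of eigenvectors of $\bar A[x]$ for $w$ and $-w$ respectively, there exist positive semidefinite real symmetric matrices $\bar U\in\mathbb{R}^{\bar t\times\bar t}$ and $\bar V\in\mathbb{R}^{\bar s\times\bar s}$ such that $\mathrm{tr}(\bar U)+\mathrm{tr}(\bar V)=1$ and $$\mathrm{tr}\big(\bar Q_1^t(E_k+E_{n+k})\bar Q_1\bar U\big)-\mathrm{tr}\big(\bar Q_2^t(E_k+E_{n+k})\bar Q_2\bar V\big)=0,\quad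 k=1,\dots,n.$$
   Context: $M_n^h(\mathbb{C})$ is the set of Hermitian $n\times n$ complex matrices; $\lambda_i$ denotes eigenvalues; $\|\cdot\|$ is the spectral norm; $\mathrm{Diag}(y)$ is the diagonal matrix with diagonal $y$. For a matrix $Y$, $\Re(Y)=\frac12(Y+\overline{Y})$ and $\Im(Y)=\frac1{2i}(Y-\overline{Y})$ (entrywise conjugation). $E_k=e_ke_k^*$ where $\{e_k\}_{k=1}^{2n}$ is the canonical basis of $\mathbb{R}^{2n}$. $A(x)$ is minimal if $\|A(x)\|\le\|A(y)\|$ for every $y\in\mathbb{R}^n$. *)

theory Defs
  imports "HOL-Analysis.Analysis" "Jordan_Normal_Form.Spectral_Radius"
    "Jordan_Normal_Form.Schur_Decomposition"
begin

no_notation Finite_Cartesian_Product.vec_nth (infixl \<open>$\<close> 90)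

text \<open>Matrices and vectors are those with explicit dimensions, since the multiplicities that
  give the sizes of \<open>Q\<^sub>1, Q\<^sub>2, U, V\<close> depend on the matrix. Indices start at \<open>0\<close>.\<close>

definition euclid_norm :: "'a::real_normed_field Matrix.vec \<Rightarrow> real" where
  "euclid_norm v = L2_set (\<lambda>i. norm (v $ i)) {..<dim_vec v}"

text \<open>The operator norm induced by the Euclidean norm, over the reals and over the complex numbers.
  The closed unit ball is nonempty in every dimension and its image is bounded, so the
  supremum is the genuine one.\<close>

definition spectral_norm :: "'a::real_normed_field Matrix.mat \<Rightarrow> real" where
  "spectral_norm A =
     (SUP v \<in> {v \<in> carrier_vec (dim_col A). euclid_norm v \<le> 1}. euclid_norm (A *\<^sub>v v))"

definition hermitian_mat :: "complex Matrix.mat \<Rightarrow> bool" where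
  "hermitian_mat A \<longleftrightarrow> mat_adjoint A = A"

definition Diag :: "'a::zero Matrix.vec \<Rightarrow> 'a Matrix.mat" where
  "Diag y = mat_diag (dim_vec y) (\<lambda>i. y $ i)"

definition shifted :: "complex Matrix.mat \<Rightarrow> real Matrix.vec \<Rightarrow> complex Matrix.mat" where
  "shifted A\<^sub>0 y = A\<^sub>0 + Diag (map_vec complex_of_real y)"

definition real_shifted :: "complex Matrix.mat \<Rightarrow> real Matrix.vec \<Rightarrow> real Matrix.mat" where
  "real_shifted A\<^sub>0 y =
     (let n = dim_vec y in
       four_block_mat (map_mat Re A\<^sub>0) (- map_mat Im A\<^sub>0)
                      (map_mat Im A\<^sub>0) (map_mat Re A\<^sub>0)
       + four_block_mat (Diag y) (0\<^sub>m n n)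
                        (0\<^sub>m n n) (Diag y))"

definition minimal_at :: "complex Matrix.mat \<Rightarrow> nat \<Rightarrow> real Matrix.vec \<Rightarrow> bool" where
  "minimal_at A\<^sub>0 n x \<longleftrightarrow>
     (\<forall>y \<in> carrier_vec n. spectral_norm (shifted A\<^sub>0 x) \<le> spectral_norm (shifted A\<^sub>0 y))"

definition largest_eigenvalue :: "real Matrix.mat \<Rightarrow> real \<Rightarrow> bool" where
  "largest_eigenvalue M a \<longleftrightarrow> eigenvalue M a \<and> (\<forall>b. eigenvalue M b \<longrightarrow> b \<le> a)"

definition smallest_eigenvalue :: "real Matrix.mat \<Rightarrow> real \<Rightarrow> bool" where
  "smallest_eigenvalue M a \<longleftrightarrow> eigenvalue M a \<and> (\<forall>b. eigenvalue M b \<longrightarrow> a \<le> b)"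

text \<open>Algebraic multiplicity; the matrices considered are symmetric, so it is also the dimension
  of the eigenspace, and orthonormal eigenbases with this number of columns exist.\<close>

definition eigen_multiplicity :: "real Matrix.mat \<Rightarrow> real \<Rightarrow> nat" where
  "eigen_multiplicity M a = Polynomial.order a (char_poly M)"

definition eigenspace :: "real Matrix.mat \<Rightarrow> real \<Rightarrow> real Matrix.vec set" where
  "eigenspace M a = {v \<in> carrier_vec (dim_row M). M *\<^sub>v v = a \<cdot>\<^sub>v v}"

definition orthonormal_eigenbasis ::
    "real Matrix.mat \<Rightarrow> real \<Rightarrow> real Matrix.mat \<Rightarrow> bool" where
  "orthonormal_eigenbasis M a Q \<longleftrightarrow>
     Q \<in> carrier_mat (dim_row M) (eigen_multiplicity M a) \<and>
     transpose_mat Q * Q = 1\<^sub>m (eigen_multiplicity M a) \<and>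
     vec_space.col_space (dim_row M) Q = eigenspace M a"

definition mat_trace :: "'a::comm_monoid_add Matrix.mat \<Rightarrow> 'a" where
  "mat_trace A = (\<Sum>i<dim_row A. A $$ (i, i))"

definition psd_mat :: "nat \<Rightarrow> real Matrix.mat \<Rightarrow> bool" where
  "psd_mat m U \<longleftrightarrow>
     U \<in> carrier_mat m m \<and> transpose_mat U = U \<and>
     (\<forall>v \<in> carrier_vec m. 0 \<le> v \<bullet> (U *\<^sub>v v))"

definition unit_proj :: "nat \<Rightarrow> nat \<Rightarrow> real Matrix.mat" where
  "unit_proj N k = mat_of_cols N [unit_vec N k] * mat_of_rows N [unit_vec N k]"

end

theory Submission
  imports Defs
begin

text \<open>Under \<open>v \<mapsto> (Re v, Im v)\<close> the matrix \<open>shifted A\<^sub>0 y\<close> becomes the real symmetric matrix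
  \<open>real_shifted A\<^sub>0 y\<close>, so both have the same spectral norm; for Hermitian matrices this norm is
  the spectral radius. That settles the first two conditions.

  Condition (3) is a dual certificate. Put \<open>X = Q\<^sub>1 U Q\<^sub>1\<^sup>t\<close> and \<open>Y = Q\<^sub>2 V Q\<^sub>2\<^sup>t\<close>. The balance equations
  make \<open>tr ((X - Y) M y)\<close> independent of \<open>y\<close>; at \<open>x\<close> it equals \<open>w\<close>, and it is at most \<open>\<parallel>M y\<parallel>\<close>, so \<open>x\<close>
  is minimal. Conversely, let \<open>w = \<parallel>M x\<parallel>\<close> be minimal and consider, for positive semidefinite \<open>X, Y\<close>
  with \<open>tr X + tr Y = 1\<close>, the compact convex set of points with coordinates
  \<open>tr ((X - Y) (E\<^sub>k + E\<^sub>n\<^sub>+\<^sub>k))\<close> and \<open>tr ((X - Y) M x)\<close>. If \<open>(0, w)\<close> were not in it, the residual of the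
  closest point would give a shift \<open>y\<close> with \<open>\<parallel>M y\<parallel> < w\<close>. If it is, the inequalities
  \<open>tr (X M) \<le> w tr X\<close> and \<open>- tr (Y M) \<le> w tr Y\<close> are equalities, so \<open>X\<close> and \<open>Y\<close> live on the eigenspaces
  of \<open>w\<close> and \<open>-w\<close>; the balance equations give \<open>tr X = tr Y = 1/2\<close>, so these are nonzero.\<close>

no_notation inner (infix "\<bullet>" 70)

section \<open>Quadratic forms and the closest point argument\<close>

text \<open>A closed condition inside a product of intervals \<open>{-1..1}\<close> and singletons
  \<open>{0}\<close>, which is compact by Tychonoff. Pinning the coordinates outside
  \<open>I\<close> to \<open>0\<close> keeps that product compact in the topology of all
  functions.\<close>

lemma compact_unit_sphere_fun:
  fixes I :: "'i set"
  assumes I: "finite I"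
  shows "compact {f :: 'i \<Rightarrow> real. (\<forall>i. i \<notin> I \<longrightarrow> f i = 0) \<and> (\<Sum>i\<in>I. (f i)\<^sup>2) = 1}"
    (is "compact ?S")
proof -
  let ?B = "PiE UNIV (\<lambda>i. if i \<in> I then {-1..1} else {0::real})"
  have "compactin (product_topology (\<lambda>_. euclidean) UNIV) ?B"
    unfolding compactin_PiE by auto
  hence B: "compact ?B"
    by (simp add: euclidean_product_topology)
  have C: "closed {f :: 'i \<Rightarrow> real. (\<Sum>i\<in>I. (f i)\<^sup>2) = 1}"
    by (intro closed_Collect_eq continuous_intros continuous_on_product_coordinates)
  have "f i \<in> {-1..1}" if "(\<Sum>i\<in>I. (f i)\<^sup>2) = 1" "i \<in> I" for f :: "'i \<Rightarrow> real" and i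
  proof -
    have "(f i)\<^sup>2 \<le> (\<Sum>i\<in>I. (f i)\<^sup>2)"
      by (rule member_le_sum) (use that I in auto)
    thus ?thesis
      using that by (simp add: abs_square_le_1 abs_le_iff)
  qed
  hence "?S = ?B \<inter> {f. (\<Sum>i\<in>I. (f i)\<^sup>2) = 1}"
    by (auto simp: PiE_iff split: if_splits)
  thus ?thesis
    using compact_Int_closed[OF B C] by simp
qed

text \<open>Summed over a family \<open>L r\<close>, this is the trace of \<open>P\<close> against
  the Gram matrix \<open>\<Sum>r. L r i * L r j\<close>; traces such as \<open>tr (X P)\<close>
  enter in this form.\<close>

definition qform :: "'i set \<Rightarrow> ('i \<Rightarrow> 'i \<Rightarrow> real) \<Rightarrow> ('i \<Rightarrow> real) \<Rightarrow> real" where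
  "qform I P v = (\<Sum>i\<in>I. \<Sum>j\<in>I. P i j * v i * v j)"

lemma qform_identity:
  "finite I \<Longrightarrow> qform I (\<lambda>i j. if i = j then 1 else 0) v = (\<Sum>i\<in>I. (v i)\<^sup>2)"
  by (simp add: qform_def power2_eq_square if_distrib[of "\<lambda>x. x * _"] cong: if_cong)

lemma qform_scale: "qform I P (\<lambda>i. c * v i) = c\<^sup>2 * qform I P v"
  by (simp add: qform_def sum_distrib_left power2_eq_square mult_ac)

lemma qform_insert:
  assumes "finite I" "a \<notin> I" "\<forall>i\<in>I. A i a = A a i"
  shows "qform (insert a I) A (v(a := c))
    = A a a * c\<^sup>2 + 2 * c * (\<Sum>i\<in>I. A a i * v i) + qform I A v"
proof -
  have "(\<Sum>i\<in>I. \<Sum>j\<in>insert a I. A i j * (v(a := c)) i * (v(a := c)) j)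
      = (\<Sum>i\<in>I. A a i * v i * c + (\<Sum>j\<in>I. A i j * v i * v j))"
    by (rule sum.cong) (use assms in \<open>auto intro!: sum.cong\<close>)
  moreover have "(\<Sum>j\<in>insert a I. A a j * (v(a := c)) a * (v(a := c)) j)
      = A a a * c * c + (\<Sum>i\<in>I. c * (A a i * v i))"
    using assms by (auto intro!: sum.cong)
  ultimately show ?thesis
    using assms
    by (simp add: qform_def sum.distrib power2_eq_square mult_ac flip: sum_distrib_left)
qed

text \<open>The induction step is a Schur complement. When the pivot \<open>A a a\<close> is \<open>0\<close>, so is its row, and
  the convention \<open>t / 0 = 0\<close> makes the same formulas correct.\<close>

lemma psd_gram:
  fixes A :: "'i \<Rightarrow> 'i \<Rightarrow> real"
  assumes "finite I" "\<forall>i\<in>I. \<forall>j\<in>I. A i j = A j i" "\<forall>v. 0 \<le> qform I A v"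
  shows "\<exists>L. \<forall>i\<in>I. \<forall>j\<in>I. A i j = (\<Sum>r\<in>I. L r i * L r j)"
  using assms
proof (induction I arbitrary: A rule: finite_induct)
  case empty
  thus ?case by simp
next
  case (insert a I)
  note exp = qform_insert[OF insert.hyps, of A]
  have sym: "\<forall>i\<in>I. A i a = A a i"
    using insert.prems(1) by blast
  have nonneg: "0 \<le> A a a * c\<^sup>2 + 2 * c * (\<Sum>i\<in>I. A a i * v i) + qform I A v" for v c
    using insert.prems(2) exp[OF sym, of v c] by metis
  have "0 \<le> A a a"
    using nonneg[of 1 "\<lambda>_. 0"] by (simp add: qform_def)
  have zero: "A a i = 0" if "A a a = 0" "i \<in> I" for i
  proof (rule ccontr)
    assume ne: "A a i \<noteq> 0"
    let ?e = "\<lambda>j. if j = i then 1 else (0::real)"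
    have s: "(\<Sum>j\<in>I. A a j * ?e j) = A a i"
      using that insert.hyps by (simp add: if_distrib cong: if_cong)
    let ?q = "qform I A ?e"
    \<comment> \<open>With zero pivot the form at \<open>?e\<close> is affine in \<open>c\<close>
      with slope \<open>2 * A a i\<close>; this \<open>c\<close> gives it the value
      \<open>-1\<close>.\<close>
    have "2 * (- (?q + 1) / (2 * A a i)) * A a i = - (?q + 1)"
      using ne by simp
    moreover have "0 \<le> 2 * (- (?q + 1) / (2 * A a i)) * A a i + ?q"
      using nonneg[of "- (?q + 1) / (2 * A a i)" ?e] that s by simp
    ultimately show False by linarith
  qed
  define A' where "A' i j = A i j - A a i * A a j / A a a" for i j
  have "\<exists>L. \<forall>i\<in>I. \<forall>j\<in>I. A' i j = (\<Sum>r\<in>I. L r i * L r j)"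
  proof (rule insert.IH)
    show "\<forall>i\<in>I. \<forall>j\<in>I. A' i j = A' j i"
      unfolding A'_def using insert.prems(1) by (metis insertCI mult.commute)
    show "\<forall>v. 0 \<le> qform I A' v"
    proof
      fix v
      let ?s = "\<Sum>i\<in>I. A a i * v i"
      have "qform I A' v = qform I A v - (\<Sum>i\<in>I. \<Sum>j\<in>I. (A a i * v i) * (A a j * v j) / A a a)"
        unfolding qform_def A'_def sum_subtractf[symmetric]
        by (intro sum.cong refl) (simp add: algebra_simps)
      also have "\<dots> = qform I A v - ?s\<^sup>2 / A a a"
        by (simp add: power2_eq_square sum_product flip: sum_divide_distrib)
      \<comment> \<open>For a positive pivot, \<open>c = - ?s / A a a\<close> minimises the
        quadratic in \<open>c\<close>, and the minimum is exactly this difference. For a zero pivot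
        the division convention gives \<open>c = 0\<close>.\<close>
      also have "\<dots> \<ge> 0"
        using nonneg[of "- ?s / A a a" v]
        by (cases "A a a = 0") (auto simp: field_simps power2_eq_square)
      finally show "0 \<le> qform I A' v" .
    qed
  qed
  then obtain L where L: "\<forall>i\<in>I. \<forall>j\<in>I. A' i j = (\<Sum>r\<in>I. L r i * L r j)" by blast
  \<comment> \<open>One Cholesky step: row \<open>a\<close> is the pivot row divided by
    \<open>sqrt (A a a)\<close>, and the rows of the smaller factor are padded with \<open>0\<close>
    in column \<open>a\<close>.\<close>
  define L' where "L' r i = (if r = a then A a i / sqrt (A a a) else if i = a then 0 else L r i)" for r i
  have "A i j = (\<Sum>r\<in>insert a I. L' r i * L' r j)" if ij: "i \<in> insert a I" "j \<in> insert a I" for i j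
  proof -
    have 1: "(\<Sum>r\<in>I. L' r i * L' r j) = (if i = a \<or> j = a then 0 else A' i j)"
    proof -
      have "(\<Sum>r\<in>I. L' r i * L' r j) = (\<Sum>r\<in>I. if i = a \<or> j = a then 0 else L r i * L r j)"
        by (rule sum.cong) (use insert.hyps in \<open>auto simp: L'_def\<close>)
      thus ?thesis using L ij by auto
    qed
    have 2: "L' a i * L' a j = A a i * A a j / A a a"
      using \<open>0 \<le> A a a\<close> by (simp add: L'_def)
    have 3: "A i j = A a i * A a j / A a a" if "i = a \<or> j = a"
      using that zero ij sym by (cases "A a a = 0") (auto simp: field_simps)
    have "(\<Sum>r\<in>insert a I. L' r i * L' r j)
        = A a i * A a j / A a a + (if i = a \<or> j = a then 0 else A' i j)"
      using insert.hyps 1 2 by simp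
    thus ?thesis
      using 3 by (auto simp: A'_def)
  qed
  thus ?case by blast
qed

lemma gram_mix:
  fixes L :: "'i \<Rightarrow> 'i \<Rightarrow> real"
  assumes I: "finite I" and "0 \<le> a" "0 \<le> b"
  shows "\<exists>L'. \<forall>P. (\<Sum>r\<in>I. qform I P (L' r)) = a * (\<Sum>r\<in>I. qform I P (L r)) + b * qform I P v"
proof -
  define A where "A i j = a * (\<Sum>r\<in>I. L r i * L r j) + b * (v i * v j)" for i j
  have tr: "(\<Sum>r\<in>I. qform I P (K r)) = (\<Sum>i\<in>I. \<Sum>j\<in>I. P i j * (\<Sum>r\<in>I. K r i * K r j))" for P K
  proof -
    have "(\<Sum>r\<in>I. qform I P (K r)) = (\<Sum>i\<in>I. \<Sum>r\<in>I. \<Sum>j\<in>I. P i j * K r i * K r j)"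
      unfolding qform_def by (rule sum.swap)
    also have "\<dots> = (\<Sum>i\<in>I. \<Sum>j\<in>I. \<Sum>r\<in>I. P i j * K r i * K r j)"
      by (intro sum.cong refl sum.swap)
    finally show ?thesis by (simp add: sum_distrib_left mult_ac)
  qed
  have trA: "(\<Sum>i\<in>I. \<Sum>j\<in>I. P i j * A i j) = a * (\<Sum>r\<in>I. qform I P (L r)) + b * qform I P v" for P
  proof -
    have "(\<Sum>i\<in>I. \<Sum>j\<in>I. P i j * A i j) = (\<Sum>i\<in>I. \<Sum>j\<in>I. a * (P i j * (\<Sum>r\<in>I. L r i * L r j)))
       + (\<Sum>i\<in>I. \<Sum>j\<in>I. b * (P i j * v i * v j))"
      unfolding A_def sum.distrib[symmetric]
      by (intro sum.cong refl) (simp add: algebra_simps)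
    thus ?thesis
      unfolding tr by (simp add: qform_def sum_distrib_left)
  qed
  have "\<exists>L'. \<forall>i\<in>I. \<forall>j\<in>I. A i j = (\<Sum>r\<in>I. L' r i * L' r j)"
  proof (rule psd_gram[OF I])
    show "\<forall>i\<in>I. \<forall>j\<in>I. A i j = A j i"
      by (simp add: A_def mult_ac)
    show "\<forall>u. 0 \<le> qform I A u"
    proof
      fix u
      \<comment> \<open>\<open>qform I A u\<close> is the pairing of \<open>A\<close> with the rank
        one matrix \<open>u i * u j\<close>, so \<open>trA\<close> expresses it as a nonnegative
        combination of squares.\<close>
      have sq: "qform I (\<lambda>i j. u i * u j) w = (\<Sum>i\<in>I. u i * w i)\<^sup>2" for w
        by (simp add: qform_def power2_eq_square sum_product mult_ac)
      have "qform I A u = (\<Sum>i\<in>I. \<Sum>j\<in>I. (u i * u j) * A i j)"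
        by (simp add: qform_def mult_ac)
      thus "0 \<le> qform I A u"
        unfolding trA sq using assms by (simp add: sum_nonneg)
    qed
  qed
  then obtain L' where "\<forall>i\<in>I. \<forall>j\<in>I. A i j = (\<Sum>r\<in>I. L' r i * L' r j)" by blast
  hence "(\<Sum>r\<in>I. qform I P (L' r)) = a * (\<Sum>r\<in>I. qform I P (L r)) + b * qform I P v" for P
    unfolding tr[of P L'] trA[symmetric] by (intro sum.cong refl) simp
  thus ?thesis by blast
qed

text \<open>First-order condition at a minimum: divide by \<open>t\<close> and let \<open>t\<close>
  tend to \<open>0\<close>. The limit is replaced by one \<open>t\<close> so small that
  \<open>t * b\<close> is at most \<open>a\<close>.\<close>

lemma nonpos_if_le_small:
  fixes a b :: real
  assumes "\<And>t. 0 < t \<Longrightarrow> t \<le> 1 \<Longrightarrow> 2 * t * a \<le> t\<^sup>2 * b"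
  shows "a \<le> 0"
proof (rule ccontr)
  assume "\<not> a \<le> 0"
  define t where "t = min 1 (a / (\<bar>b\<bar> + 1))"
  have t: "0 < t" "t \<le> 1" "t \<le> a / (\<bar>b\<bar> + 1)"
    using \<open>\<not> a \<le> 0\<close> by (auto simp: t_def)
  have "t * (2 * a) \<le> t * (t * b)"
    using assms[OF t(1,2)] by (simp add: power2_eq_square mult_ac)
  hence "2 * a \<le> t * b"
    using t(1) by simp
  also have "\<dots> \<le> t * (\<bar>b\<bar> + 1)"
    using t(1) by simp
  also have "\<dots> \<le> a"
    using t(3) by (simp add: field_simps)
  finally show False using \<open>\<not> a \<le> 0\<close> by simp
qed

text \<open>Positive semidefinite \<open>X, Y\<close> are parametrised as sums of the rank one matrices given by the
  vectors \<open>L r, K r\<close>, so that the feasible set is a compact sphere; convexity of its image is lemma \<open>gram_mix\<close>.\<close>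

lemma closest_point_certificate:
  fixes P :: "'k \<Rightarrow> 'i \<Rightarrow> 'i \<Rightarrow> real" and \<tau> :: "'k \<Rightarrow> real"
  assumes I: "finite I" "I \<noteq> {}" and J: "finite J"
  shows "(\<exists>L K. (\<Sum>r\<in>I. \<Sum>i\<in>I. (L r i)\<^sup>2) + (\<Sum>r\<in>I. \<Sum>i\<in>I. (K r i)\<^sup>2) = 1 \<and>
      (\<forall>k\<in>J. (\<Sum>r\<in>I. qform I (P k) (L r)) - (\<Sum>r\<in>I. qform I (P k) (K r)) = \<tau> k)) \<or>
    (\<exists>\<rho>. 0 < (\<Sum>k\<in>J. (\<rho> k)\<^sup>2) \<and>
      (\<forall>v. \<bar>\<Sum>k\<in>J. \<rho> k * qform I (P k) v\<bar>
         \<le> ((\<Sum>k\<in>J. \<rho> k * \<tau> k) - (\<Sum>k\<in>J. (\<rho> k)\<^sup>2)) * (\<Sum>i\<in>I. (v i)\<^sup>2)))"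
proof -
  \<comment> \<open>Packs both families into one function, \<open>True\<close> marking
    \<open>L\<close> and \<open>False\<close> marking \<open>K\<close>, so that the trace condition
    becomes a unit sphere.\<close>
  define D where "D = (UNIV :: bool set) \<times> I \<times> I"
  have "finite D" using I by (simp add: D_def)
  define S where "S = {z :: bool \<times> 'i \<times> 'i \<Rightarrow> real. (\<forall>p. p \<notin> D \<longrightarrow> z p = 0) \<and> (\<Sum>p\<in>D. (z p)\<^sup>2) = 1}"
  have "compact S"
    unfolding S_def by (rule compact_unit_sphere_fun) fact
  define F where "F Q z = (\<Sum>r\<in>I. qform I Q (\<lambda>i. z (True, r, i)))
      - (\<Sum>r\<in>I. qform I Q (\<lambda>i. z (False, r, i)))" for Q and z :: "bool \<times> 'i \<times> 'i \<Rightarrow> real"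
  have D_sum: "(\<Sum>p\<in>D. (z p)\<^sup>2) = (\<Sum>r\<in>I. \<Sum>i\<in>I. (z (True, r, i))\<^sup>2) + (\<Sum>r\<in>I. \<Sum>i\<in>I. (z (False, r, i))\<^sup>2)"
    for z :: "bool \<times> 'i \<times> 'i \<Rightarrow> real"
    unfolding D_def using I by (simp add: sum.cartesian_product' UNIV_bool)
  have mk: "\<exists>z\<in>S. \<forall>Q. F Q z = (\<Sum>r\<in>I. qform I Q (L r)) - (\<Sum>r\<in>I. qform I Q (K r))"
    if "(\<Sum>r\<in>I. \<Sum>i\<in>I. (L r i)\<^sup>2) + (\<Sum>r\<in>I. \<Sum>i\<in>I. (K r i)\<^sup>2) = 1" for L K
  proof
    let ?z = "\<lambda>(b, r, i). if r \<in> I \<and> i \<in> I then if b then L r i else K r i else 0"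
    show "?z \<in> S"
      unfolding S_def mem_Collect_eq D_sum[of ?z] using that by (auto simp: D_def)
    show "\<forall>Q. F Q ?z = (\<Sum>r\<in>I. qform I Q (L r)) - (\<Sum>r\<in>I. qform I Q (K r))"
      by (simp add: F_def qform_def)
  qed
  obtain i0 where i0: "i0 \<in> I" using I by blast
  have "(\<Sum>r\<in>I. \<Sum>i\<in>I. (if r = i0 \<and> i = i0 then 1 else (0::real))\<^sup>2) = 1"
  proof -
    have "(\<Sum>r\<in>I. \<Sum>i\<in>I. (if r = i0 \<and> i = i0 then 1 else (0::real))\<^sup>2)
        = (\<Sum>r\<in>I. if r = i0 then \<Sum>i\<in>I. if i = i0 then 1 else 0 else 0)"
      by (intro sum.cong refl) (auto intro!: sum.cong)
    thus ?thesis using I i0 by simp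
  qed
  hence "S \<noteq> {}"
    using mk[of "\<lambda>r i. if r = i0 \<and> i = i0 then 1 else 0" "\<lambda>_ _. 0"] by auto
  have "continuous_on S (\<lambda>z. \<Sum>k\<in>J. (\<tau> k - F (P k) z)\<^sup>2)"
    unfolding F_def qform_def
    by (intro continuous_intros continuous_on_subset[OF continuous_on_product_coordinates] subset_UNIV)
  from continuous_attains_inf[OF \<open>compact S\<close> \<open>S \<noteq> {}\<close> this]
  obtain z where z: "z \<in> S"
    and min: "\<And>y. y \<in> S \<Longrightarrow> (\<Sum>k\<in>J. (\<tau> k - F (P k) z)\<^sup>2) \<le> (\<Sum>k\<in>J. (\<tau> k - F (P k) y)\<^sup>2)"
    by blast
  define L K where "L = (\<lambda>r i. z (True, r, i))" and "K = (\<lambda>r i. z (False, r, i))"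
  have Fz: "F Q z = (\<Sum>r\<in>I. qform I Q (L r)) - (\<Sum>r\<in>I. qform I Q (K r))" for Q
    by (simp add: F_def L_def K_def)
  have norm1: "(\<Sum>r\<in>I. \<Sum>i\<in>I. (L r i)\<^sup>2) + (\<Sum>r\<in>I. \<Sum>i\<in>I. (K r i)\<^sup>2) = 1"
    using z by (simp add: S_def D_sum L_def K_def)
  \<comment> \<open>The residual at the closest point; if nonzero, it is the normal of a hyperplane
    separating \<tau> from the attainable points.\<close>
  define \<rho> where "\<rho> k = \<tau> k - F (P k) z" for k
  show ?thesis
  proof (cases "\<forall>k\<in>J. \<rho> k = 0")
    case True
    thus ?thesis
      using norm1 by (intro disjI1 exI[of _ L] exI[of _ K]) (simp add: \<rho>_def Fz)
  next
    case False
    then obtain k0 where "k0 \<in> J" "\<rho> k0 \<noteq> 0" by blast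
    hence pos: "0 < (\<Sum>k\<in>J. (\<rho> k)\<^sup>2)"
      using J by (intro sum_pos2[of J k0]) auto
    \<comment> \<open>The value of the functional \<rho> at the closest point: it lies below the
      value at \<tau> by the squared distance.\<close>
    define \<beta> where "\<beta> = (\<Sum>k\<in>J. \<rho> k * \<tau> k) - (\<Sum>k\<in>J. (\<rho> k)\<^sup>2)"
    have \<beta>: "\<beta> = (\<Sum>k\<in>J. \<rho> k * F (P k) z)"
      unfolding \<beta>_def sum_subtractf[symmetric]
      by (intro sum.cong refl) (simp add: \<rho>_def power2_eq_square algebra_simps)
    \<comment> \<open>\<open>\<epsilon> = 1\<close> moves the closest point towards
      \<open>v v^t\<close> as \<open>X\<close>, \<open>\<epsilon> = -1\<close> towards
      \<open>v v^t\<close> as \<open>Y\<close>; the weights in \<open>nn\<close> give the whole mass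
      \<open>t\<close> to that side. Minimality of the distance along the segment yields the
      inequality to first order in \<open>t\<close>.\<close>
    have unit: "\<epsilon> * (\<Sum>k\<in>J. \<rho> k * qform I (P k) v) \<le> \<beta>"
      if v: "(\<Sum>i\<in>I. (v i)\<^sup>2) = 1" and \<epsilon>: "\<epsilon> = 1 \<or> \<epsilon> = -1" for v and \<epsilon> :: real
    proof -
      define d where "d k = \<epsilon> * qform I (P k) v - F (P k) z" for k
      have "(\<Sum>k\<in>J. \<rho> k * d k) \<le> 0"
      proof (rule nonpos_if_le_small)
        fix t :: real assume t: "0 < t" "t \<le> 1"
        have nn: "0 \<le> 1 - t" "0 \<le> t * (1 + \<epsilon>) / 2" "0 \<le> t * (1 - \<epsilon>) / 2"
          using t \<epsilon> by auto
        obtain L' where L': "(\<Sum>r\<in>I. qform I Q (L' r))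
            = (1 - t) * (\<Sum>r\<in>I. qform I Q (L r)) + t * (1 + \<epsilon>) / 2 * qform I Q v" for Q
          using gram_mix[OF I(1) nn(1,2), of L v] by metis
        obtain K' where K': "(\<Sum>r\<in>I. qform I Q (K' r))
            = (1 - t) * (\<Sum>r\<in>I. qform I Q (K r)) + t * (1 - \<epsilon>) / 2 * qform I Q v" for Q
          using gram_mix[OF I(1) nn(1,3), of K v] by metis
        let ?id = "\<lambda>i j :: 'i. if i = j then 1 else (0::real)"
        have "(\<Sum>r\<in>I. \<Sum>i\<in>I. (L' r i)\<^sup>2) + (\<Sum>r\<in>I. \<Sum>i\<in>I. (K' r i)\<^sup>2)
          = (1 - t) * ((\<Sum>r\<in>I. \<Sum>i\<in>I. (L r i)\<^sup>2) + (\<Sum>r\<in>I. \<Sum>i\<in>I. (K r i)\<^sup>2)) + t"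
          using L'[of ?id] K'[of ?id] v unfolding qform_identity[OF I(1)]
          by (simp add: field_simps)
        hence "(\<Sum>r\<in>I. \<Sum>i\<in>I. (L' r i)\<^sup>2) + (\<Sum>r\<in>I. \<Sum>i\<in>I. (K' r i)\<^sup>2) = 1"
          by (simp add: norm1)
        from mk[OF this] obtain y where y: "y \<in> S"
          and Fy: "\<And>Q. F Q y = (\<Sum>r\<in>I. qform I Q (L' r)) - (\<Sum>r\<in>I. qform I Q (K' r))"
          by metis
        have "F Q y = F Q z + t * (\<epsilon> * qform I Q v - F Q z)" for Q
          unfolding Fy L' K' Fz by (simp add: field_simps)
        hence step: "\<tau> k - F (P k) y = \<rho> k - t * d k" for k
          by (simp add: \<rho>_def d_def)
        have "(\<Sum>k\<in>J. (\<rho> k)\<^sup>2) \<le> (\<Sum>k\<in>J. (\<rho> k - t * d k)\<^sup>2)"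
          using min[OF y] by (simp only: step \<rho>_def[symmetric])
        also have "\<dots> = (\<Sum>k\<in>J. (\<rho> k)\<^sup>2) - 2 * t * (\<Sum>k\<in>J. \<rho> k * d k) + t\<^sup>2 * (\<Sum>k\<in>J. (d k)\<^sup>2)"
          unfolding sum_distrib_left sum_subtractf[symmetric] sum.distrib[symmetric]
          by (intro sum.cong refl) (simp add: power2_eq_square algebra_simps)
        finally show "2 * t * (\<Sum>k\<in>J. \<rho> k * d k) \<le> t\<^sup>2 * (\<Sum>k\<in>J. (d k)\<^sup>2)"
          by simp
      qed
      moreover have "(\<Sum>k\<in>J. \<rho> k * d k) = \<epsilon> * (\<Sum>k\<in>J. \<rho> k * qform I (P k) v) - \<beta>"
        unfolding \<beta> d_def sum_distrib_left sum_subtractf[symmetric]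
        by (intro sum.cong refl) (simp add: algebra_simps)
      ultimately show ?thesis by simp
    qed
    have "\<bar>\<Sum>k\<in>J. \<rho> k * qform I (P k) v\<bar> \<le> \<beta> * (\<Sum>i\<in>I. (v i)\<^sup>2)" for v
    proof (cases "(\<Sum>i\<in>I. (v i)\<^sup>2) = 0")
      case True
      hence "\<forall>i\<in>I. v i = 0"
        using I by (simp add: sum_nonneg_eq_0_iff)
      hence "qform I (P k) v = 0" for k
        by (simp add: qform_def)
      thus ?thesis using True by simp
    next
      case False
      define s where "s = (\<Sum>i\<in>I. (v i)\<^sup>2)"
      have s: "0 < s"
        using False by (simp add: s_def sum_nonneg order.not_eq_order_implies_strict)
      define u where "u i = (1 / sqrt s) * v i" for i
      have "(\<Sum>i\<in>I. (u i)\<^sup>2) = (\<Sum>i\<in>I. (v i)\<^sup>2 / s)"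
        by (intro sum.cong refl) (use s in \<open>simp add: u_def power_divide\<close>)
      hence u: "(\<Sum>i\<in>I. (u i)\<^sup>2) = 1"
        using s by (simp add: s_def flip: sum_divide_distrib)
      have q: "qform I (P k) u = qform I (P k) v / s" for k
        unfolding u_def qform_scale using s by (simp add: power_divide)
      have "\<bar>(\<Sum>k\<in>J. \<rho> k * qform I (P k) v) / s\<bar> \<le> \<beta>"
        using unit[OF u, of 1] unit[OF u, of "-1"]
        by (simp add: q abs_le_iff sum_divide_distrib)
      thus ?thesis
        using s by (simp add: field_simps flip: s_def)
    qed
    thus ?thesis
      using pos unfolding \<beta>_def by blast
  qed
qed

section \<open>Spectral norms of real symmetric matrices\<close>

lemma euclid_norm_nonneg: "0 \<le> euclid_norm v"
  by (simp add: euclid_norm_def L2_set_nonneg)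

lemma euclid_norm_power2: "(euclid_norm v)\<^sup>2 = (\<Sum>i<dim_vec v. (norm (v $ i))\<^sup>2)"
  by (simp add: euclid_norm_def L2_set_def sum_nonneg)

lemma euclid_norm_power2_real: "(euclid_norm v)\<^sup>2 = v \<bullet> v" for v :: "real Matrix.vec"
  unfolding euclid_norm_power2 by (simp add: scalar_prod_def lessThan_atLeast0 power2_eq_square)

lemma euclid_norm_smult: "euclid_norm (c \<cdot>\<^sub>v v) = norm c * euclid_norm v"
  by (simp add: euclid_norm_def L2_set_def norm_mult power_mult_distrib real_sqrt_mult
      flip: sum_distrib_left)

lemma euclid_norm_eq_0_iff: "euclid_norm v = 0 \<longleftrightarrow> v = 0\<^sub>v (dim_vec v)"
proof
  assume "euclid_norm v = 0"
  hence "\<forall>i<dim_vec v. v $ i = 0"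
    by (auto simp: euclid_norm_def L2_set_eq_0_iff)
  thus "v = 0\<^sub>v (dim_vec v)"
    by (intro eq_vecI) auto
next
  assume "v = 0\<^sub>v (dim_vec v)"
  hence "\<forall>i<dim_vec v. v $ i = 0"
    by (metis index_zero_vec(1))
  thus "euclid_norm v = 0"
    by (simp add: euclid_norm_def L2_set_def)
qed

lemma euclid_norm_zero: "euclid_norm (0\<^sub>v m) = 0"
  by (simp add: euclid_norm_def L2_set_def)

text \<open>The sum of the norms of all entries is a crude bound on the unit ball. It is what lets
  the supremum in \<open>spectral_norm\<close> act as an upper bound.\<close>

lemma spectral_norm_bdd_above:
  fixes A :: "'a::real_normed_field Matrix.mat"
  shows "bdd_above ((\<lambda>v. euclid_norm (A *\<^sub>v v)) ` {v \<in> carrier_vec (dim_col A). euclid_norm v \<le> 1})"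
proof (rule bdd_aboveI2)
  fix v :: "'a Matrix.vec"
  assume v: "v \<in> {v \<in> carrier_vec (dim_col A). euclid_norm v \<le> 1}"
  have "norm ((A *\<^sub>v v) $ i) \<le> (\<Sum>j<dim_col A. norm (A $$ (i, j)))" if "i < dim_row A" for i
  proof -
    have "(A *\<^sub>v v) $ i = (\<Sum>j<dim_col A. A $$ (i, j) * v $ j)"
      using v that by (auto simp: scalar_prod_def lessThan_atLeast0 intro!: sum.cong)
    also have "norm \<dots> \<le> (\<Sum>j<dim_col A. norm (A $$ (i, j) * v $ j))"
      by (rule norm_sum)
    also have "\<dots> \<le> (\<Sum>j<dim_col A. norm (A $$ (i, j)))"
    proof (rule sum_mono)
      fix j assume "j \<in> {..<dim_col A}"
      hence "norm (v $ j) \<le> euclid_norm v"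
        using v unfolding euclid_norm_def by (intro member_le_L2_set) auto
      hence "norm (v $ j) \<le> 1"
        using v by simp
      thus "norm (A $$ (i, j) * v $ j) \<le> norm (A $$ (i, j))"
        by (simp add: norm_mult mult_left_le)
    qed
    finally show ?thesis .
  qed
  moreover have "euclid_norm (A *\<^sub>v v) \<le> (\<Sum>i<dim_row A. norm ((A *\<^sub>v v) $ i))"
    unfolding euclid_norm_def by (rule order_trans[OF L2_set_le_sum]) simp_all
  ultimately show "euclid_norm (A *\<^sub>v v) \<le> (\<Sum>i<dim_row A. \<Sum>j<dim_col A. norm (A $$ (i, j)))"
    by (force intro: order_trans[OF _ sum_mono])
qed

lemma spectral_norm_nonneg: "0 \<le> spectral_norm A"
  for A :: "'a::real_normed_field Matrix.mat"
proof -
  have "(0\<^sub>v (dim_col A) :: 'a Matrix.vec) \<in> {v \<in> carrier_vec (dim_col A). euclid_norm v \<le> 1}"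
    by (simp add: euclid_norm_zero)
  from cSUP_upper[OF this spectral_norm_bdd_above] show ?thesis
    unfolding spectral_norm_def using euclid_norm_nonneg order_trans by blast
qed

lemma euclid_norm_mult_mat_vec_le:
  fixes A :: "'a::real_normed_field Matrix.mat"
  assumes v: "v \<in> carrier_vec (dim_col A)"
  shows "euclid_norm (A *\<^sub>v v) \<le> spectral_norm A * euclid_norm v"
proof (cases "euclid_norm v = 0")
  case True
  hence "v = 0\<^sub>v (dim_col A)"
    using v euclid_norm_eq_0_iff by (metis carrier_vecD)
  hence "A *\<^sub>v v = 0\<^sub>v (dim_vec (A *\<^sub>v v))"
    by (intro eq_vecI) auto
  thus ?thesis
    using True euclid_norm_eq_0_iff[of "A *\<^sub>v v"] by simp
next
  case False
  hence pos: "0 < euclid_norm v"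
    using euclid_norm_nonneg[of v] by simp
  define c :: 'a where "c = of_real (1 / euclid_norm v)"
  have c: "norm c = 1 / euclid_norm v"
    using pos by (simp add: c_def norm_divide)
  have "c \<cdot>\<^sub>v v \<in> {v \<in> carrier_vec (dim_col A). euclid_norm v \<le> 1}"
    using v pos by (simp add: euclid_norm_smult c)
  from cSUP_upper[OF this spectral_norm_bdd_above]
  have "euclid_norm (A *\<^sub>v (c \<cdot>\<^sub>v v)) \<le> spectral_norm A"
    unfolding spectral_norm_def .
  also have "A *\<^sub>v (c \<cdot>\<^sub>v v) = c \<cdot>\<^sub>v (A *\<^sub>v v)"
    using v by (intro mult_mat_vec[of _ "dim_row A" "dim_col A"]) auto
  finally show ?thesis
    using pos by (simp add: euclid_norm_smult c field_simps)
qed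

lemma spectral_norm_le:
  fixes A :: "'a::real_normed_field Matrix.mat"
  assumes "0 \<le> b"
    and "\<And>v. v \<in> carrier_vec (dim_col A) \<Longrightarrow> euclid_norm (A *\<^sub>v v) \<le> b * euclid_norm v"
  shows "spectral_norm A \<le> b"
  unfolding spectral_norm_def
proof (rule cSUP_least)
  have "(0\<^sub>v (dim_col A) :: 'a Matrix.vec) \<in> {v \<in> carrier_vec (dim_col A). euclid_norm v \<le> 1}"
    by (simp add: euclid_norm_zero)
  thus "{v :: 'a Matrix.vec. v \<in> carrier_vec (dim_col A) \<and> euclid_norm v \<le> 1} \<noteq> {}" by blast
next
  fix v :: "'a Matrix.vec"
  assume "v \<in> {v \<in> carrier_vec (dim_col A). euclid_norm v \<le> 1}"
  thus "euclid_norm (A *\<^sub>v v) \<le> b"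
    using assms(2)[of v] mult_left_le[of "euclid_norm v" b] assms(1) by simp
qed

section \<open>Norms and eigenvectors read off from quadratic forms\<close>

lemma abs_scalar_prod_le:
  fixes u v :: "real Matrix.vec"
  assumes "u \<in> carrier_vec N" "v \<in> carrier_vec N"
  shows "\<bar>u \<bullet> v\<bar> \<le> euclid_norm u * euclid_norm v"
proof -
  have "\<bar>u \<bullet> v\<bar> \<le> (\<Sum>i<N. \<bar>u $ i\<bar> * \<bar>v $ i\<bar>)"
    using assms by (simp add: scalar_prod_def lessThan_atLeast0 abs_mult[symmetric])
  also have "\<dots> \<le> L2_set (\<lambda>i. u $ i) {..<N} * L2_set (\<lambda>i. v $ i) {..<N}"
    by (rule L2_set_mult_ineq)
  finally show ?thesis
    using assms by (simp add: euclid_norm_def L2_set_def)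
qed

lemma abs_quadratic_le_spectral_norm:
  fixes M :: "real Matrix.mat"
  assumes M: "M \<in> carrier_mat N N" and v: "v \<in> carrier_vec N"
  shows "\<bar>v \<bullet> (M *\<^sub>v v)\<bar> \<le> spectral_norm M * (v \<bullet> v)"
proof -
  have "\<bar>v \<bullet> (M *\<^sub>v v)\<bar> \<le> euclid_norm v * euclid_norm (M *\<^sub>v v)"
    using M v by (intro abs_scalar_prod_le[of _ N]) auto
  also have "\<dots> \<le> euclid_norm v * (spectral_norm M * euclid_norm v)"
    using M v by (intro mult_left_mono euclid_norm_mult_mat_vec_le euclid_norm_nonneg) auto
  finally show ?thesis
    by (simp add: power2_eq_square mult_ac flip: euclid_norm_power2_real)
qed

lemma symmetric_scalar_prod:
  fixes M :: "real Matrix.mat"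
  assumes "M \<in> carrier_mat N N" "transpose_mat M = M" "u \<in> carrier_vec N" "v \<in> carrier_vec N"
  shows "(M *\<^sub>v u) \<bullet> v = u \<bullet> (M *\<^sub>v v)"
  using transpose_vec_mult_scalar[of M N N v u] assms by simp

text \<open>Converse to \<open>abs_quadratic_le_spectral_norm\<close>, by polarisation: the mixed
  term is a difference of the form at \<open>u + v\<close> and at \<open>u - v\<close>, and the
  parallelogram law adds up the two bounds.\<close>

lemma spectral_norm_le_quadratic:
  fixes M :: "real Matrix.mat"
  assumes M: "M \<in> carrier_mat N N" "transpose_mat M = M" and b: "0 \<le> b"
    and q: "\<And>v. v \<in> carrier_vec N \<Longrightarrow> \<bar>v \<bullet> (M *\<^sub>v v)\<bar> \<le> b * (v \<bullet> v)"
  shows "spectral_norm M \<le> b"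
proof (rule spectral_norm_le[OF b])
  fix v :: "real Matrix.vec" assume "v \<in> carrier_vec (dim_col M)"
  hence v: "v \<in> carrier_vec N" using M by simp
  have polar: "2 * (u \<bullet> (M *\<^sub>v v)) \<le> b * (u \<bullet> u + v \<bullet> v)" if u: "u \<in> carrier_vec N" for u
  proof -
    have c: "M *\<^sub>v u \<in> carrier_vec N" "M *\<^sub>v v \<in> carrier_vec N"
      using M u v by auto
    have s: "v \<bullet> (M *\<^sub>v u) = u \<bullet> (M *\<^sub>v v)"
      using symmetric_scalar_prod[OF M v u] comm_scalar_prod[OF c(2) u] by simp
    have 1: "(u + v) \<bullet> (M *\<^sub>v (u + v)) = u \<bullet> (M *\<^sub>v u) + 2 * (u \<bullet> (M *\<^sub>v v)) + v \<bullet> (M *\<^sub>v v)"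
      using u v c s
      by (simp add: mult_add_distrib_mat_vec[OF M(1)] add_scalar_prod_distrib[of _ N]
          scalar_prod_add_distrib[of _ N])
    have 2: "(u - v) \<bullet> (M *\<^sub>v (u - v)) = u \<bullet> (M *\<^sub>v u) - 2 * (u \<bullet> (M *\<^sub>v v)) + v \<bullet> (M *\<^sub>v v)"
      using u v c s
      by (simp add: mult_minus_distrib_mat_vec[OF M(1)] minus_scalar_prod_distrib[of _ N]
          scalar_prod_minus_distrib[of _ N])
    have 3: "(u + v) \<bullet> (u + v) + (u - v) \<bullet> (u - v) = 2 * (u \<bullet> u + v \<bullet> v)"
      using u v
      by (simp add: minus_scalar_prod_distrib[of _ N] scalar_prod_minus_distrib[of _ N]
          add_scalar_prod_distrib[of _ N] scalar_prod_add_distrib[of _ N])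
    have "4 * (u \<bullet> (M *\<^sub>v v)) = (u + v) \<bullet> (M *\<^sub>v (u + v)) - (u - v) \<bullet> (M *\<^sub>v (u - v))"
      using 1 2 by simp
    also have "\<dots> \<le> b * ((u + v) \<bullet> (u + v)) + b * ((u - v) \<bullet> (u - v))"
      using q[of "u + v"] q[of "u - v"] u v by (auto simp: abs_le_iff)
    also have "\<dots> = 2 * (b * (u \<bullet> u + v \<bullet> v))"
      unfolding distrib_left[symmetric] 3 by simp
    finally show ?thesis by simp
  qed
  define p r where "p = euclid_norm v" and "r = euclid_norm (M *\<^sub>v v)"
  show "euclid_norm (M *\<^sub>v v) \<le> b * euclid_norm v"
  proof (cases "r = 0 \<or> p = 0")
    case True
    have "r = 0" if "p = 0"
      using euclid_norm_mult_mat_vec_le[of v M] v M that euclid_norm_nonneg[of "M *\<^sub>v v"]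
      by (simp add: p_def r_def)
    thus ?thesis
      using True b by (auto simp: p_def r_def euclid_norm_nonneg)
  next
    case False
    hence pos: "0 < p" "0 < r"
      using euclid_norm_nonneg[of v] euclid_norm_nonneg[of "M *\<^sub>v v"]
      by (auto simp: p_def r_def)
    have Mv: "M *\<^sub>v v \<in> carrier_vec N" using M v by auto
    \<comment> \<open>Here \<open>u\<close> is \<open>M *\<^sub>v v\<close> rescaled to the length
      \<open>p\<close> of \<open>v\<close>, which makes the two terms on the right of
      \<open>polar\<close> equal.\<close>
    have "2 * (p / r * r\<^sup>2) \<le> b * ((p / r) * (p / r) * r\<^sup>2 + p\<^sup>2)"
      using polar[of "(p / r) \<cdot>\<^sub>v (M *\<^sub>v v)"] Mv v
      by (simp add: p_def r_def euclid_norm_power2_real mult_ac)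
    hence "p * r \<le> p * (b * p)"
      using pos by (simp add: power2_eq_square field_simps)
    thus ?thesis
      using pos by (simp add: p_def r_def)
  qed
qed

text \<open>Expanding the squared length of \<open>M *\<^sub>v v - w \<cdot>\<^sub>v v\<close>
  leaves \<open>|M v|^2 - w^2 |v|^2\<close>, which is not positive because
  \<open>\<bar>w\<bar>\<close> is the norm. This is how equality in the trace bounds forces
  eigenvectors.\<close>

lemma eigenvector_if_quadratic_extremal:
  fixes M :: "real Matrix.mat"
  assumes M: "M \<in> carrier_mat N N" and v: "v \<in> carrier_vec N"
    and w: "\<bar>w\<bar> = spectral_norm M" and ext: "v \<bullet> (M *\<^sub>v v) = w * (v \<bullet> v)"
  shows "M *\<^sub>v v = w \<cdot>\<^sub>v v"
proof -
  define d where "d = M *\<^sub>v v - w \<cdot>\<^sub>v v"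
  have Mv: "M *\<^sub>v v \<in> carrier_vec N" and d: "d \<in> carrier_vec N"
    using M v by (auto simp: d_def)
  have "d \<bullet> d = (M *\<^sub>v v) \<bullet> (M *\<^sub>v v) - 2 * w * (v \<bullet> (M *\<^sub>v v)) + w * w * (v \<bullet> v)"
    unfolding d_def using Mv v comm_scalar_prod[OF Mv v]
    by (simp add: minus_scalar_prod_distrib[of _ N] scalar_prod_minus_distrib[of _ N] algebra_simps)
  also have "\<dots> = (euclid_norm (M *\<^sub>v v))\<^sup>2 - (\<bar>w\<bar> * euclid_norm v)\<^sup>2"
    by (simp add: ext euclid_norm_power2_real power_mult_distrib power2_eq_square[of w])
  also have "\<dots> \<le> 0"
    using euclid_norm_mult_mat_vec_le[of v M] M v
    by (simp add: w power_mono euclid_norm_nonneg)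
  finally have "euclid_norm d = 0"
    by (simp flip: euclid_norm_power2_real)
  hence "d = 0\<^sub>v N"
    using d euclid_norm_eq_0_iff by (metis carrier_vecD)
  hence "(M *\<^sub>v v) $ i - (w \<cdot>\<^sub>v v) $ i = 0" if "i < N" for i
    using that v by (metis d_def index_minus_vec(1) index_zero_vec(1) index_smult_vec(2) carrier_vecD)
  thus ?thesis
    using Mv v M by (intro eq_vecI) auto
qed

lemma quadratic_eq_qform:
  assumes "M \<in> carrier_mat N N" "v \<in> carrier_vec N"
  shows "v \<bullet> (M *\<^sub>v v) = qform {0..<N} (\<lambda>i j. M $$ (i, j)) (\<lambda>i. v $ i)"
  using assms
  by (simp add: qform_def scalar_prod_def sum_distrib_left mult_ac)

text \<open>By compactness the absolute quadratic form has a maximiser on the unit sphere; its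
  maximum is the norm, and the maximiser is an eigenvector. The signed value of the form is the
  eigenvalue, so either end of the spectrum may occur.\<close>

lemma symmetric_norm_attained:
  fixes M :: "real Matrix.mat"
  assumes M: "M \<in> carrier_mat N N" "transpose_mat M = M" and N: "0 < N"
  shows "\<exists>w v. \<bar>w\<bar> = spectral_norm M \<and> v \<in> carrier_vec N \<and> v \<noteq> 0\<^sub>v N \<and> M *\<^sub>v v = w \<cdot>\<^sub>v v"
proof -
  let ?I = "{0..<N}"
  define S where "S = {f :: nat \<Rightarrow> real. (\<forall>i. i \<notin> ?I \<longrightarrow> f i = 0) \<and> (\<Sum>i\<in>?I. (f i)\<^sup>2) = 1}"
  define q where "q = qform ?I (\<lambda>i j. M $$ (i, j))"
  have "compact S"
    unfolding S_def by (rule compact_unit_sphere_fun) simp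
  have "(\<lambda>i. if i = 0 then 1 else 0) \<in> S"
    using N by (auto simp: S_def if_distrib[of "\<lambda>x. x\<^sup>2"] cong: if_cong)
  hence "S \<noteq> {}" by blast
  have "continuous_on S (\<lambda>f. \<bar>q f\<bar>)"
    unfolding q_def qform_def
    by (intro continuous_intros continuous_on_subset[OF continuous_on_product_coordinates] subset_UNIV)
  from continuous_attains_sup[OF \<open>compact S\<close> \<open>S \<noteq> {}\<close> this]
  obtain f where f: "f \<in> S" and max: "\<And>g. g \<in> S \<Longrightarrow> \<bar>q g\<bar> \<le> \<bar>q f\<bar>" by blast
  define v where "v = Matrix.vec N f"
  have v: "v \<in> carrier_vec N" by (simp add: v_def)
  have vv: "v \<bullet> v = 1"
    using f by (simp add: v_def S_def scalar_prod_def power2_eq_square)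
  have vM: "v \<bullet> (M *\<^sub>v v) = q f"
    using M v by (simp add: quadratic_eq_qform q_def qform_def v_def)
  have "spectral_norm M \<le> \<bar>q f\<bar>"
  proof (rule spectral_norm_le_quadratic[OF M])
    fix u :: "real Matrix.vec" assume u: "u \<in> carrier_vec N"
    show "\<bar>u \<bullet> (M *\<^sub>v u)\<bar> \<le> \<bar>q f\<bar> * (u \<bullet> u)"
    proof (cases "u \<bullet> u = 0")
      case True
      thus ?thesis
        using abs_quadratic_le_spectral_norm[OF M(1) u] by simp
    next
      case False
      hence pos: "0 < u \<bullet> u"
        by (metis euclid_norm_power2_real zero_le_power2 order.not_eq_order_implies_strict)
      define g where "g i = (if i < N then (1 / sqrt (u \<bullet> u)) * u $ i else 0)" for i
      have "(\<Sum>i\<in>?I. (g i)\<^sup>2) = (\<Sum>i\<in>?I. u $ i * u $ i / (u \<bullet> u))"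
        by (intro sum.cong refl) (use pos in \<open>simp add: g_def power_divide power2_eq_square\<close>)
      also have "\<dots> = 1"
        using u pos by (simp add: scalar_prod_def flip: sum_divide_distrib)
      finally have "g \<in> S" by (simp add: S_def g_def)
      moreover have "q g = (u \<bullet> (M *\<^sub>v u)) / (u \<bullet> u)"
      proof -
        have "q g = q (\<lambda>i. (1 / sqrt (u \<bullet> u)) * u $ i)"
          by (simp add: q_def qform_def g_def)
        also have "\<dots> = (1 / sqrt (u \<bullet> u))\<^sup>2 * (u \<bullet> (M *\<^sub>v u))"
          unfolding q_def qform_scale quadratic_eq_qform[OF M(1) u] ..
        finally show ?thesis using pos by (simp add: power_divide)
      qed
      ultimately show ?thesis
        using max[of g] pos by (simp add: pos_divide_le_eq)
    qed
  qed simp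
  moreover have "\<bar>q f\<bar> \<le> spectral_norm M"
    using abs_quadratic_le_spectral_norm[OF M(1) v] by (simp add: vM vv)
  ultimately have w: "\<bar>q f\<bar> = spectral_norm M" by simp
  have "M *\<^sub>v v = q f \<cdot>\<^sub>v v"
    by (rule eigenvector_if_quadratic_extremal[OF M(1) v w]) (simp add: vM vv)
  moreover have "v \<noteq> 0\<^sub>v N" using vv by auto
  ultimately show ?thesis using w v by blast
qed

section \<open>The real form of a Hermitian matrix\<close>

text \<open>The matrix of \<open>v \<mapsto> H *\<^sub>v v\<close> as a real linear map, in the
  coordinates of \<open>real_vec\<close>.\<close>

definition real_rep :: "complex Matrix.mat \<Rightarrow> real Matrix.mat" where
  "real_rep H = four_block_mat (map_mat Re H) (- map_mat Im H) (map_mat Im H) (map_mat Re H)"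

definition real_vec :: "complex Matrix.vec \<Rightarrow> real Matrix.vec" where
  "real_vec v = map_vec Re v @\<^sub>v map_vec Im v"

lemma real_rep_carrier: "H \<in> carrier_mat n n \<Longrightarrow> real_rep H \<in> carrier_mat (2 * n) (2 * n)"
  by (simp add: real_rep_def mult_2)

lemma real_vec_carrier: "v \<in> carrier_vec n \<Longrightarrow> real_vec v \<in> carrier_vec (2 * n)"
  by (simp add: real_vec_def mult_2)

lemma real_vec_surj:
  assumes u: "u \<in> carrier_vec (2 * n)"
  shows "\<exists>v\<in>carrier_vec n. u = real_vec v"
proof
  let ?v = "Matrix.vec n (\<lambda>i. Complex (u $ i) (u $ (n + i)))"
  show "?v \<in> carrier_vec n" by simp
  show "u = real_vec ?v"
    using u by (intro eq_vecI) (auto simp: real_vec_def)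
qed

lemma real_vec_eq_0_iff:
  assumes "v \<in> carrier_vec n"
  shows "real_vec v = 0\<^sub>v (2 * n) \<longleftrightarrow> v = 0\<^sub>v n"
proof
  assume z: "real_vec v = 0\<^sub>v (2 * n)"
  have "v $ i = 0" if "i < n" for i
    using arg_cong[OF z, of "\<lambda>u. u $ i"] arg_cong[OF z, of "\<lambda>u. u $ (n + i)"] assms that
    by (simp add: real_vec_def complex_eq_iff)
  thus "v = 0\<^sub>v n" using assms by (intro eq_vecI) auto
next
  assume "v = 0\<^sub>v n"
  thus "real_vec v = 0\<^sub>v (2 * n)"
    by (intro eq_vecI) (auto simp: real_vec_def)
qed

lemma real_vec_smult: "real_vec (complex_of_real c \<cdot>\<^sub>v v) = c \<cdot>\<^sub>v real_vec v"
  by (intro eq_vecI) (auto simp: real_vec_def)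

lemma real_vec_inj:
  assumes "real_vec u = real_vec v" "u \<in> carrier_vec n" "v \<in> carrier_vec n"
  shows "u = v"
proof (rule eq_vecI)
  show "dim_vec u = dim_vec v" using assms by simp
  fix i assume "i < dim_vec v"
  thus "u $ i = v $ i"
    using arg_cong[OF assms(1), of "\<lambda>u. u $ i"] arg_cong[OF assms(1), of "\<lambda>u. u $ (n + i)"] assms
    by (simp add: real_vec_def complex_eq_iff)
qed

lemma euclid_norm_real_vec: "euclid_norm (real_vec v) = euclid_norm v"
proof -
  let ?n = "dim_vec v"
  have split: "(\<Sum>i<a + b. f i) = (\<Sum>i<a. f i) + (\<Sum>i<b. f (a + i))" for f :: "nat \<Rightarrow> real" and a b
    by (induction b) (simp_all add: add.assoc)
  have "(\<Sum>i<?n + ?n. (norm (real_vec v $ i))\<^sup>2)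
      = (\<Sum>i<?n. (norm (real_vec v $ i))\<^sup>2) + (\<Sum>i<?n. (norm (real_vec v $ (?n + i)))\<^sup>2)"
    by (rule split)
  also have "\<dots> = (\<Sum>i<?n. (norm (v $ i))\<^sup>2)"
    unfolding sum.distrib[symmetric]
    by (intro sum.cong refl) (simp add: real_vec_def cmod_power2)
  finally have eq: "(\<Sum>i<?n + ?n. (norm (real_vec v $ i))\<^sup>2) = (\<Sum>i<?n. (norm (v $ i))\<^sup>2)" .
  have "dim_vec (real_vec v) = ?n + ?n"
    by (simp add: real_vec_def)
  thus ?thesis
    unfolding euclid_norm_def L2_set_def by (simp only: eq)
qed

text \<open>The two halves are the real and imaginary parts of complex products, row by row. The
  identity carries norms and eigenvectors between the two sides.\<close>

lemma real_rep_mult_vec: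
  assumes H: "H \<in> carrier_mat n n" and v: "v \<in> carrier_vec n"
  shows "real_rep H *\<^sub>v real_vec v = real_vec (H *\<^sub>v v)"
proof -
  have "real_rep H *\<^sub>v real_vec v
      = (map_mat Re H *\<^sub>v map_vec Re v + (- map_mat Im H) *\<^sub>v map_vec Im v) @\<^sub>v
        (map_mat Im H *\<^sub>v map_vec Re v + map_mat Re H *\<^sub>v map_vec Im v)"
    unfolding real_rep_def real_vec_def
    by (rule four_block_mat_mult_vec) (use H v in auto)
  also have "map_mat Re H *\<^sub>v map_vec Re v + (- map_mat Im H) *\<^sub>v map_vec Im v = map_vec Re (H *\<^sub>v v)"
  proof (rule eq_vecI)
    fix i assume "i < dim_vec (map_vec Re (H *\<^sub>v v))"
    hence i: "i < n" using H by simp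
    have "(map_mat Re H *\<^sub>v map_vec Re v + (- map_mat Im H) *\<^sub>v map_vec Im v) $ i
        = (\<Sum>j = 0..<n. Re (H $$ (i, j)) * Re (v $ j)) + (\<Sum>j = 0..<n. - Im (H $$ (i, j)) * Im (v $ j))"
      using H v i by (simp add: scalar_prod_def sum_negf)
    also have "\<dots> = (\<Sum>j = 0..<n. Re (H $$ (i, j) * v $ j))"
      unfolding sum.distrib[symmetric] by (intro sum.cong refl) simp
    also have "\<dots> = map_vec Re (H *\<^sub>v v) $ i"
      using H v i by (simp add: scalar_prod_def)
    finally show "(map_mat Re H *\<^sub>v map_vec Re v + (- map_mat Im H) *\<^sub>v map_vec Im v) $ i
        = map_vec Re (H *\<^sub>v v) $ i" .
  qed (use H in auto)
  also have "map_mat Im H *\<^sub>v map_vec Re v + map_mat Re H *\<^sub>v map_vec Im v = map_vec Im (H *\<^sub>v v)"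
  proof (rule eq_vecI)
    fix i assume "i < dim_vec (map_vec Im (H *\<^sub>v v))"
    hence i: "i < n" using H by simp
    have "(map_mat Im H *\<^sub>v map_vec Re v + map_mat Re H *\<^sub>v map_vec Im v) $ i
        = (\<Sum>j = 0..<n. Im (H $$ (i, j)) * Re (v $ j)) + (\<Sum>j = 0..<n. Re (H $$ (i, j)) * Im (v $ j))"
      using H v i by (simp add: scalar_prod_def)
    also have "\<dots> = (\<Sum>j = 0..<n. Im (H $$ (i, j) * v $ j))"
      unfolding sum.distrib[symmetric] by (intro sum.cong refl) simp
    also have "\<dots> = map_vec Im (H *\<^sub>v v) $ i"
      using H v i by (simp add: scalar_prod_def)
    finally show "(map_mat Im H *\<^sub>v map_vec Re v + map_mat Re H *\<^sub>v map_vec Im v) $ i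
        = map_vec Im (H *\<^sub>v v) $ i" .
  qed (use H in auto)
  finally show ?thesis by (simp add: real_vec_def)
qed

text \<open>\<open>real_vec\<close> maps the complex unit ball onto the real one and preserves
  lengths, so the two suprema run over the same values.\<close>

lemma spectral_norm_real_rep:
  assumes H: "H \<in> carrier_mat n n"
  shows "spectral_norm (real_rep H) = spectral_norm H"
proof -
  let ?B = "{v \<in> carrier_vec n. euclid_norm v \<le> 1} :: complex Matrix.vec set"
  have B: "{u \<in> carrier_vec (2 * n). euclid_norm u \<le> 1} = real_vec ` ?B"
  proof
    show "{u \<in> carrier_vec (2 * n). euclid_norm u \<le> 1} \<subseteq> real_vec ` ?B"
    proof
      fix u :: "real Matrix.vec"
      assume u: "u \<in> {u \<in> carrier_vec (2 * n). euclid_norm u \<le> 1}"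
      then obtain v where "v \<in> carrier_vec n" "u = real_vec v"
        using real_vec_surj by blast
      thus "u \<in> real_vec ` ?B"
        using u by (simp add: euclid_norm_real_vec)
    qed
    show "real_vec ` ?B \<subseteq> {u \<in> carrier_vec (2 * n). euclid_norm u \<le> 1}"
      using real_vec_carrier by (auto simp: euclid_norm_real_vec)
  qed
  have "spectral_norm (real_rep H) = (SUP u \<in> real_vec ` ?B. euclid_norm (real_rep H *\<^sub>v u))"
    by (simp only: spectral_norm_def carrier_matD(2)[OF real_rep_carrier[OF H]] B)
  also have "\<dots> = (SUP v \<in> ?B. euclid_norm (real_rep H *\<^sub>v real_vec v))"
    by (simp add: image_image)
  also have "\<dots> = (SUP v \<in> ?B. euclid_norm (H *\<^sub>v v))"
    by (rule SUP_cong) (auto simp: real_rep_mult_vec[OF H] euclid_norm_real_vec)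
  also have "\<dots> = spectral_norm H"
    by (simp only: spectral_norm_def carrier_matD(2)[OF H])
  finally show ?thesis .
qed

section \<open>Symmetry of the real form and the spectral radius of Hermitian matrices\<close>

lemma hermitian_matD:
  assumes "hermitian_mat H" "H \<in> carrier_mat n n" "i < n" "j < n"
  shows "H $$ (j, i) = cnj (H $$ (i, j))"
proof -
  have 1: "mat_adjoint H = H" using assms(1) unfolding hermitian_mat_def .
  have 2: "mat_adjoint H $$ (j, i) = cnj (H $$ (i, j))"
    using assms(2-4) by (simp add: mat_adjoint_def mat_of_rows_def)
  show ?thesis
    using 2 unfolding 1 .
qed

text \<open>The real part is symmetric and the imaginary part antisymmetric; the sign change of the
  latter compensates the exchange of the off-diagonal blocks.\<close>

lemma real_rep_symmetric:
  assumes H: "H \<in> carrier_mat n n" and herm: "\<And>i j. i < n \<Longrightarrow> j < n \<Longrightarrow> H $$ (j, i) = cnj (H $$ (i, j))"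
  shows "transpose_mat (real_rep H) = real_rep H"
proof -
  have re: "transpose_mat (map_mat Re H) = map_mat Re H"
  proof (rule eq_matI)
    fix i j assume "i < dim_row (map_mat Re H)" "j < dim_col (map_mat Re H)"
    thus "transpose_mat (map_mat Re H) $$ (i, j) = map_mat Re H $$ (i, j)"
      using H arg_cong[OF herm[of i j], of Re] by simp
  qed (use H in auto)
  have im: "transpose_mat (map_mat Im H) = - map_mat Im H"
  proof (rule eq_matI)
    fix i j assume "i < dim_row (- map_mat Im H)" "j < dim_col (- map_mat Im H)"
    thus "transpose_mat (map_mat Im H) $$ (i, j) = (- map_mat Im H) $$ (i, j)"
      using H arg_cong[OF herm[of i j], of Im] by simp
  qed (use H in auto)
  have "transpose_mat (- map_mat Im H) = - transpose_mat (map_mat Im H)"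
    by (intro eq_matI) auto
  hence im': "transpose_mat (- map_mat Im H) = map_mat Im H"
    by (simp add: im)
  have c: "map_mat Re H \<in> carrier_mat n n" "- map_mat Im H \<in> carrier_mat n n"
    "map_mat Im H \<in> carrier_mat n n"
    using H by auto
  show ?thesis
    unfolding real_rep_def transpose_four_block_mat[OF c(1,2,3,1)] re im im' ..
qed

lemma shifted_carrier:
  "A \<in> carrier_mat n n \<Longrightarrow> y \<in> carrier_vec n \<Longrightarrow> shifted A y \<in> carrier_mat n n"
  by (simp add: shifted_def Diag_def mat_diag_def)

lemma shifted_hermitian:
  assumes "hermitian_mat A" "A \<in> carrier_mat n n" "y \<in> carrier_vec n" "i < n" "j < n"
  shows "shifted A y $$ (j, i) = cnj (shifted A y $$ (i, j))"
proof -
  have "Re (A $$ (j, i)) = Re (A $$ (i, j))" "Im (A $$ (j, i)) = - Im (A $$ (i, j))"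
    using arg_cong[OF hermitian_matD[OF assms(1,2,4,5)], of Re]
      arg_cong[OF hermitian_matD[OF assms(1,2,4,5)], of Im] by simp_all
  thus ?thesis
    using assms(2-5)
    by (cases "i = j") (simp_all add: shifted_def Diag_def mat_diag_def complex_eq_iff)
qed

text \<open>The shift is real, so it changes only the real part, that is, the two diagonal
  blocks.\<close>

lemma real_shifted_eq_real_rep:
  assumes "A \<in> carrier_mat n n" "y \<in> carrier_vec n"
  shows "real_shifted A y = real_rep (shifted A y)"
proof -
  have D: "Diag y \<in> carrier_mat n n"
    using assms by (simp add: Diag_def)
  have re: "map_mat Re (shifted A y) = map_mat Re A + Diag y"
    by (rule eq_matI) (use assms in \<open>auto simp: shifted_def Diag_def mat_diag_def\<close>)
  have im: "map_mat Im (shifted A y) = map_mat Im A"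
    by (rule eq_matI) (use assms in \<open>auto simp: shifted_def Diag_def mat_diag_def\<close>)
  have "real_shifted A y = four_block_mat (map_mat Re A + Diag y) (- map_mat Im A + 0\<^sub>m n n)
      (map_mat Im A + 0\<^sub>m n n) (map_mat Re A + Diag y)"
    unfolding real_shifted_def Let_def carrier_vecD[OF assms(2)]
    by (rule add_four_block_mat) (use assms D in auto)
  thus ?thesis
    unfolding real_rep_def re im using assms(1) by simp
qed

text \<open>Every eigenvector bounds its eigenvalue by the norm. Conversely the real form has an
  eigenvector whose eigenvalue attains the norm up to sign, and reading its halves as real and
  imaginary parts gives a complex eigenvector for the same eigenvalue.\<close>

lemma spectral_radius_eq_spectral_norm:
  assumes H: "H \<in> carrier_mat n n" and n: "0 < n"
    and herm: "\<And>i j. i < n \<Longrightarrow> j < n \<Longrightarrow> H $$ (j, i) = cnj (H $$ (i, j))"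
  shows "spectral_radius H = spectral_norm H"
proof (rule antisym)
  obtain k where k: "eigenvalue H k" "spectral_radius H = norm k"
    using spectral_radius_mem_max(1)[OF H n] by (auto simp: spectrum_def)
  then obtain v where v: "v \<in> carrier_vec n" "v \<noteq> 0\<^sub>v n" "H *\<^sub>v v = k \<cdot>\<^sub>v v"
    using H by (auto simp: eigenvalue_def eigenvector_def)
  have "norm k * euclid_norm v \<le> spectral_norm H * euclid_norm v"
    using euclid_norm_mult_mat_vec_le[of v H] v H by (simp add: euclid_norm_smult)
  moreover have "0 < euclid_norm v"
    using v(1,2) euclid_norm_eq_0_iff[of v] euclid_norm_nonneg[of v] by auto
  ultimately show "spectral_radius H \<le> spectral_norm H"
    by (simp add: k(2))
next
  obtain w u where w: "\<bar>w\<bar> = spectral_norm (real_rep H)" and u: "u \<in> carrier_vec (2 * n)"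
    "u \<noteq> 0\<^sub>v (2 * n)" "real_rep H *\<^sub>v u = w \<cdot>\<^sub>v u"
    using symmetric_norm_attained[OF real_rep_carrier[OF H] real_rep_symmetric[OF H herm]] n by auto
  obtain v where v: "v \<in> carrier_vec n" "u = real_vec v"
    using real_vec_surj[OF u(1)] by blast
  have "real_vec (H *\<^sub>v v) = real_vec (complex_of_real w \<cdot>\<^sub>v v)"
    using u(3) by (simp add: v(2) real_rep_mult_vec[OF H v(1)] real_vec_smult)
  hence "H *\<^sub>v v = complex_of_real w \<cdot>\<^sub>v v"
    by (rule real_vec_inj[where n = n]) (use H v in auto)
  moreover have "v \<noteq> 0\<^sub>v n"
    using u(2) v real_vec_eq_0_iff[OF v(1)] by blast
  ultimately have "eigenvalue H (complex_of_real w)"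
    using v(1) H by (auto simp: eigenvalue_def eigenvector_def)
  hence "norm (complex_of_real w) \<in> norm ` spectrum H"
    unfolding spectrum_def by blast
  from spectral_radius_mem_max(2)[OF H n this] show "spectral_norm H \<le> spectral_radius H"
    by (simp add: w spectral_norm_real_rep[OF H])
qed

section \<open>Orthonormal eigenbases\<close>

text \<open>Supplies an orthogonal change of basis with first column \<open>v\<close>. Being
  symmetric and its own inverse, it conjugates symmetric matrices to symmetric ones.\<close>

lemma householder:
  fixes v :: "real Matrix.vec"
  assumes v: "v \<in> carrier_vec N" "v \<bullet> v = 1" and N: "0 < N"
  shows "\<exists>R\<in>carrier_mat N N. transpose_mat R = R \<and> R * R = 1\<^sub>m N \<and> R *\<^sub>v unit_vec N 0 = v"
proof -
  \<comment> \<open>Householder reflection along \<open>v - e\<^sub>0\<close>. If \<open>v = e\<^sub>0\<close>, then \<open>s = 0\<close> and \<open>R\<close> is the identity.\<close>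
  define u where "u i = v $ i - (if i = 0 then 1 else 0)" for i
  define s where "s = (\<Sum>i = 0..<N. u i * u i)"
  define R where "R = Matrix.mat N N (\<lambda>(i, j). (if i = j then 1 else 0) - 2 * u i * u j / s)"
  have R: "R \<in> carrier_mat N N" by (simp add: R_def)
  \<comment> \<open>For a unit vector, the squared length of \<open>v - e_0\<close> is
    \<open>2 - 2 * v $ 0\<close>, that is \<open>- 2 * u 0\<close>; so for nonzero \<open>s\<close>
    the factor \<open>2 * u 0 / s\<close> in column \<open>0\<close> is \<open>-1\<close>.\<close>
  have "s = (\<Sum>i = 0..<N. v $ i * v $ i - 2 * (if i = 0 then v $ i else 0) + (if i = 0 then 1 else 0))"
    unfolding s_def by (rule sum.cong) (auto simp: u_def algebra_simps)
  also have "\<dots> = 2 - 2 * v $ 0"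
    using v N by (simp add: sum.distrib sum_subtractf scalar_prod_def flip: sum_distrib_left)
  finally have s: "s = - 2 * u 0" by (simp add: u_def)
  have "transpose_mat R = R"
    by (rule eq_matI) (auto simp: R_def)
  moreover have "R * R = 1\<^sub>m N"
  proof (rule eq_matI)
    fix i j assume "i < dim_row (1\<^sub>m N :: real Matrix.mat)" "j < dim_col (1\<^sub>m N :: real Matrix.mat)"
    hence ij: "i < N" "j < N" by auto
    have "(R * R) $$ (i, j) = (\<Sum>l = 0..<N. ((if i = l then 1 else 0) - 2 * u i * u l / s)
        * ((if l = j then 1 else 0) - 2 * u l * u j / s))"
      using ij by (simp add: R_def scalar_prod_def)
    also have "\<dots> = (\<Sum>l = 0..<N. (if i = l then if l = j then 1 else 0 else 0)
        - (if i = l then 2 * u l * u j / s else 0) - (if l = j then 2 * u i * u l / s else 0)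
        + 4 * u i * u j / (s * s) * (u l * u l))"
      by (rule sum.cong) (auto simp: algebra_simps)
    also have "\<dots> = (if i = j then 1 else 0) - 2 * u i * u j / s - 2 * u i * u j / s
        + 4 * u i * u j / (s * s) * s"
      using ij unfolding sum.distrib sum_subtractf sum_distrib_left[symmetric] s_def[symmetric]
      by simp
    also have "\<dots> = (if i = j then 1 else 0)"
      by (cases "s = 0") (auto simp: field_simps)
    finally show "(R * R) $$ (i, j) = 1\<^sub>m N $$ (i, j)"
      using ij by simp
  qed (use R in auto)
  moreover have "R *\<^sub>v unit_vec N 0 = v"
  proof (rule eq_vecI)
    fix i assume "i < dim_vec v"
    hence i: "i < N" using v by simp
    have "(R *\<^sub>v unit_vec N 0) $ i = R $$ (i, 0)"
      using i N R by simp
    also have "\<dots> = v $ i"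
    proof (cases "s = 0")
      case True
      hence "\<forall>i\<in>{0..<N}. u i * u i = 0"
        unfolding s_def by (subst (asm) sum_nonneg_eq_0_iff) auto
      hence "u i = 0" using i by simp
      thus ?thesis
        using i N True by (auto simp: R_def u_def)
    next
      case False
      hence "2 * u i * u 0 / s = - u i"
        by (simp add: s)
      thus ?thesis
        using i N by (auto simp: R_def u_def)
    qed
    finally show "(R *\<^sub>v unit_vec N 0) $ i = v $ i" .
  qed (use R v in auto)
  ultimately show ?thesis using R by blast
qed

lemma eigen_multiplicity_eq_0:
  assumes M: "M \<in> carrier_mat N N" and "\<not> eigenvalue M a"
  shows "eigen_multiplicity M a = 0"
  using eigenvalue_root_char_poly[OF M, of a] assms(2) order_root[of "char_poly M" a]
  by (simp add: eigen_multiplicity_def)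

text \<open>The characteristic polynomial is \<open>[:- a, 1:]\<close> times that of
  \<open>B\<close>, and root orders of a nonzero product add.\<close>

lemma eigen_multiplicity_block:
  assumes B: "B \<in> carrier_mat k k"
  shows "eigen_multiplicity (four_block_mat (Matrix.mat 1 1 (\<lambda>_. a)) (0\<^sub>m 1 k) (0\<^sub>m k 1) B) a
    = 1 + eigen_multiplicity B a"
proof -
  let ?A = "Matrix.mat 1 1 (\<lambda>_. a)"
  have "upper_triangular ?A"
    by (simp add: upper_triangular_def)
  hence 1: "char_poly ?A = [:- a, 1:]"
    by (subst char_poly_upper_triangular[of _ 1]) (auto simp: diag_mat_def)
  have "char_poly B \<noteq> 0"
    using degree_monic_char_poly[OF B] by auto
  hence nz: "[:- a, 1:] * char_poly B \<noteq> 0"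
    by (simp only: mult_eq_0_iff) simp
  have "char_poly (four_block_mat ?A (0\<^sub>m 1 k) (0\<^sub>m k 1) B) = [:- a, 1:] * char_poly B"
    unfolding 1[symmetric] by (rule char_poly_four_block_zeros_col) (use B in auto)
  thus ?thesis
    using order_power_n_n[of a 1]
    by (simp only: eigen_multiplicity_def order_mult[OF nz] power_one_right)
qed

lemma block_diag_mult_vec:
  fixes A :: "'a::comm_ring_1 Matrix.mat"
  assumes "A \<in> carrier_mat n1 m1" "B \<in> carrier_mat n2 m2" "p \<in> carrier_vec m1" "q \<in> carrier_vec m2"
  shows "four_block_mat A (0\<^sub>m n1 m2) (0\<^sub>m n2 m1) B *\<^sub>v (p @\<^sub>v q) = (A *\<^sub>v p) @\<^sub>v (B *\<^sub>v q)"
proof -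
  have "0\<^sub>m n1 m2 *\<^sub>v q = 0\<^sub>v n1" "0\<^sub>m n2 m1 *\<^sub>v p = 0\<^sub>v n2"
    using assms by (auto intro!: eq_vecI simp: scalar_prod_def)
  thus ?thesis
    using assms by (subst four_block_mat_mult_vec[of _ n1 m1 _ m2 _ n2]) auto
qed

text \<open>Deflation at the single value \<open>a\<close>: a reflection takes a unit eigenvector to
  the first basis vector, and by symmetry a smaller symmetric matrix splits off. Each round adds one
  column and lowers the algebraic multiplicity by one, until \<open>a\<close> is no longer an
  eigenvalue; so algebraic and geometric multiplicity agree.\<close>

lemma symmetric_eigenbasis:
  fixes M :: "real Matrix.mat"
  assumes "M \<in> carrier_mat N N" "transpose_mat M = M"
  shows "\<exists>Q. Q \<in> carrier_mat N (eigen_multiplicity M a) \<and>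
    transpose_mat Q * Q = 1\<^sub>m (eigen_multiplicity M a) \<and>
    (\<forall>v\<in>carrier_vec N. M *\<^sub>v v = a \<cdot>\<^sub>v v \<longleftrightarrow> (\<exists>c\<in>carrier_vec (eigen_multiplicity M a). v = Q *\<^sub>v c))"
  using assms
proof (induction N arbitrary: M)
  case (0 M)
  let ?m = "eigen_multiplicity M a"
  have m: "?m = 0"
    using 0 by (intro eigen_multiplicity_eq_0[of M 0]) (auto simp: eigenvalue_def eigenvector_def)
  show ?case
    unfolding m
    by (rule exI[of _ "0\<^sub>m 0 0"]) (use 0 in \<open>auto intro!: eq_matI eq_vecI bexI[of _ "0\<^sub>v 0"]\<close>)
next
  case (Suc k M)
  note M = Suc.prems
  show ?case
  proof (cases "eigenvalue M a")
    case False
    hence m: "eigen_multiplicity M a = 0"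
      by (rule eigen_multiplicity_eq_0[OF M(1)])
    have "M *\<^sub>v v = a \<cdot>\<^sub>v v \<longleftrightarrow> (\<exists>c\<in>carrier_vec 0. v = 0\<^sub>m (Suc k) 0 *\<^sub>v c)"
      if v: "v \<in> carrier_vec (Suc k)" for v
    proof -
      have "0\<^sub>m (Suc k) 0 *\<^sub>v c = 0\<^sub>v (Suc k)" if "c \<in> carrier_vec 0" for c :: "real Matrix.vec"
        using that by (intro eq_vecI) (auto simp: scalar_prod_def)
      moreover have "M *\<^sub>v v = a \<cdot>\<^sub>v v \<longleftrightarrow> v = 0\<^sub>v (Suc k)"
      proof
        assume "M *\<^sub>v v = a \<cdot>\<^sub>v v"
        thus "v = 0\<^sub>v (Suc k)"
          using False v M by (auto simp: eigenvalue_def eigenvector_def)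
      next
        assume "v = 0\<^sub>v (Suc k)"
        thus "M *\<^sub>v v = a \<cdot>\<^sub>v v"
          using M by (intro eq_vecI) (auto simp: scalar_prod_def)
      qed
      ultimately show ?thesis
        by (metis zero_carrier_vec)
    qed
    thus ?thesis
      unfolding m by (intro exI[of _ "0\<^sub>m (Suc k) 0"]) (auto intro!: eq_matI)
  next
    case True
    let ?N = "Suc k"
    obtain v0 where v0: "v0 \<in> carrier_vec ?N" "v0 \<noteq> 0\<^sub>v ?N" "M *\<^sub>v v0 = a \<cdot>\<^sub>v v0"
      using True M by (auto simp: eigenvalue_def eigenvector_def)
    define v where "v = (1 / euclid_norm v0) \<cdot>\<^sub>v v0"
    have v: "v \<in> carrier_vec ?N" using v0 by (simp add: v_def)
    have "euclid_norm v0 \<noteq> 0"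
      using v0(1,2) euclid_norm_eq_0_iff[of v0] by auto
    hence "v \<bullet> v = 1"
      unfolding euclid_norm_power2_real[symmetric] v_def
      by (simp add: euclid_norm_smult euclid_norm_nonneg)
    then obtain R where R: "R \<in> carrier_mat ?N ?N" "transpose_mat R = R" "R * R = 1\<^sub>m ?N"
      "R *\<^sub>v unit_vec ?N 0 = v"
      using householder[OF v] by auto
    have Mv: "M *\<^sub>v v = a \<cdot>\<^sub>v v"
      using v0 M(1) by (simp add: v_def mult_mat_vec smult_smult_assoc mult.commute)
    have RR: "R *\<^sub>v (R *\<^sub>v x) = x" if "x \<in> carrier_vec ?N" for x
      using that R(1,3) assoc_mult_mat_vec[of R ?N ?N R ?N x] by simp
    define B where "B = R * M * R"
    have B: "B \<in> carrier_mat ?N ?N"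
      using R M by (auto simp: B_def)
    have Bmul: "B *\<^sub>v x = R *\<^sub>v (M *\<^sub>v (R *\<^sub>v x))" if "x \<in> carrier_vec ?N" for x
      unfolding B_def using that R(1) M(1)
      by (simp add: assoc_mult_mat_vec[of _ ?N ?N _ ?N])
    have Bsym: "transpose_mat B = B"
      unfolding B_def using R M
      by (simp add: transpose_mult[of _ ?N ?N _ ?N] assoc_mult_mat[of _ ?N ?N _ ?N _ ?N])
    have Be: "B *\<^sub>v unit_vec ?N 0 = a \<cdot>\<^sub>v unit_vec ?N 0"
    proof -
      have "R *\<^sub>v v = unit_vec ?N 0"
        using RR[of "unit_vec ?N 0"] R(4) by simp
      thus ?thesis
        using R(1,4) v by (simp add: Bmul Mv mult_mat_vec)
    qed
    have B0: "B $$ (i, 0) = (if i = 0 then a else 0)" if "i < ?N" for i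
    proof -
      have "B $$ (i, 0) = (B *\<^sub>v unit_vec ?N 0) $ i"
        using that B by simp
      thus ?thesis
        unfolding Be using that by simp
    qed
    \<comment> \<open>Symmetry carries the zeros of column \<open>0\<close> over to row
      \<open>0\<close>, which is what splits \<open>B\<close> into blocks.\<close>
    have B0': "B $$ (0, j) = (if j = 0 then a else 0)" if "j < ?N" for j
    proof -
      have "B $$ (0, j) = transpose_mat B $$ (0, j)"
        by (simp only: Bsym)
      also have "\<dots> = B $$ (j, 0)"
        using that B by simp
      finally show ?thesis using B0[OF that] by simp
    qed
    define B' where "B' = Matrix.mat k k (\<lambda>(i, j). B $$ (Suc i, Suc j))"
    have B': "B' \<in> carrier_mat k k" by (simp add: B'_def)
    let ?A = "Matrix.mat 1 1 (\<lambda>_. a)"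
    have Bblock: "B = four_block_mat ?A (0\<^sub>m 1 k) (0\<^sub>m k 1) B'"
    proof (rule eq_matI)
      fix i j assume "i < dim_row (four_block_mat ?A (0\<^sub>m 1 k) (0\<^sub>m k 1) B')"
        "j < dim_col (four_block_mat ?A (0\<^sub>m 1 k) (0\<^sub>m k 1) B')"
      hence "i < ?N" "j < ?N" by (auto simp: B'_def)
      thus "B $$ (i, j) = four_block_mat ?A (0\<^sub>m 1 k) (0\<^sub>m k 1) B' $$ (i, j)"
        by (cases i; cases j) (auto simp: B0 B0' B'_def)
    qed (use B in \<open>auto simp: B'_def\<close>)
    have "transpose_mat B' = B'"
    proof (rule eq_matI)
      fix i j assume ij: "i < dim_row B'" "j < dim_col B'"
      have "B $$ (Suc j, Suc i) = transpose_mat B $$ (Suc i, Suc j)"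
        using ij B by (simp add: B'_def)
      thus "transpose_mat B' $$ (i, j) = B' $$ (i, j)"
        using ij by (simp add: B'_def Bsym)
    qed (auto simp: B'_def)
    from Suc.IH[OF B' this] obtain Q' where Q': "Q' \<in> carrier_mat k (eigen_multiplicity B' a)"
      "transpose_mat Q' * Q' = 1\<^sub>m (eigen_multiplicity B' a)"
      and Q'_iff: "\<And>x. x \<in> carrier_vec k \<Longrightarrow>
        B' *\<^sub>v x = a \<cdot>\<^sub>v x \<longleftrightarrow> (\<exists>c\<in>carrier_vec (eigen_multiplicity B' a). x = Q' *\<^sub>v c)"
      by blast
    define m where "m = eigen_multiplicity B' a"
    note Q' = Q'[folded m_def] Q'_iff[folded m_def]
    have "similar_mat M B"
      unfolding similar_mat_def similar_mat_wit_def Let_def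
    proof (intro exI conjI)
      show "{M, B, R, R} \<subseteq> carrier_mat (dim_row M) (dim_row M)" using M B R by auto
      show "R * R = 1\<^sub>m (dim_row M)" "R * R = 1\<^sub>m (dim_row M)" using M R by auto
      have "R * B * R = R * R * M * (R * R)"
        unfolding B_def using R(1) M(1) by (simp add: assoc_mult_mat[of _ ?N ?N _ ?N _ ?N])
      thus "M = R * B * R" using R(3) M(1) by simp
    qed
    hence mult: "eigen_multiplicity M a = 1 + m"
      unfolding m_def eigen_multiplicity_block[OF B', symmetric] Bblock[symmetric]
      by (simp add: eigen_multiplicity_def char_poly_similar)
    \<comment> \<open>Eigenbasis of the block matrix: the first basis vector, then the columns of
      \<open>Q'\<close> padded by a zero on top. Multiplication by \<open>R\<close> carries it back
      to \<open>M\<close>.\<close>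
    define D where "D = four_block_mat (1\<^sub>m 1) (0\<^sub>m 1 m) (0\<^sub>m k 1) Q'"
    have D: "D \<in> carrier_mat ?N (1 + m)"
      using Q' four_block_carrier_mat[of "1\<^sub>m 1" 1 1 Q' k m "0\<^sub>m 1 m" "0\<^sub>m k 1"]
      by (simp add: D_def)
    have DD: "transpose_mat D * D = 1\<^sub>m (1 + m)"
    proof -
      have "transpose_mat D = four_block_mat (1\<^sub>m 1) (0\<^sub>m 1 k) (0\<^sub>m m 1) (transpose_mat Q')"
        unfolding D_def by (subst transpose_four_block_mat) (use Q' in auto)
      hence "transpose_mat D * D = four_block_mat (1\<^sub>m 1) (0\<^sub>m 1 m) (0\<^sub>m m 1) (1\<^sub>m m)"
        unfolding D_def
        by (simp, subst mult_four_block_mat[of _ 1 1 _ k _ m _ _ 1 _ m]) (use Q' in auto)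
      also have "\<dots> = 1\<^sub>m (1 + m)"
        by (rule eq_matI) auto
      finally show ?thesis .
    qed
    define Q where "Q = R * D"
    have Q: "Q \<in> carrier_mat ?N (1 + m)"
      using R(1) D by (simp add: Q_def)
    have "transpose_mat Q * Q = transpose_mat D * (R * R) * D"
      unfolding Q_def using R(1,2) D
      by (simp add: transpose_mult[of R ?N ?N D "1 + m"] assoc_mult_mat[of _ _ ?N _ ?N _ ]
         assoc_mult_mat[of R ?N ?N R ?N D "1 + m"] assoc_mult_mat[of "transpose_mat D" "1 + m" ?N R ?N "R * D" "1 + m"])
    hence QQ: "transpose_mat Q * Q = 1\<^sub>m (1 + m)"
      using R(3) D DD by simp
    have Qmul: "Q *\<^sub>v c = R *\<^sub>v (D *\<^sub>v c)" if "c \<in> carrier_vec (1 + m)" for c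
      unfolding Q_def by (rule assoc_mult_mat_vec[OF R(1) D that])
    have "M *\<^sub>v x = a \<cdot>\<^sub>v x \<longleftrightarrow> (\<exists>c\<in>carrier_vec (1 + m). x = Q *\<^sub>v c)"
      if x: "x \<in> carrier_vec ?N" for x
    proof -
      let ?y = "R *\<^sub>v x"
      define p q where "p = vec_first ?y 1" and "q = vec_last ?y k"
      have pq: "p \<in> carrier_vec 1" "q \<in> carrier_vec k"
        by (simp_all add: p_def q_def)
      have y: "?y = p @\<^sub>v q"
        unfolding p_def q_def using R(1) x by (intro vec_first_last_append[symmetric]) simp
      have "M *\<^sub>v x = a \<cdot>\<^sub>v x \<longleftrightarrow> B *\<^sub>v ?y = a \<cdot>\<^sub>v ?y"
      proof -
        have 1: "B *\<^sub>v ?y = R *\<^sub>v (M *\<^sub>v x)"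
          using x R(1) by (simp add: Bmul RR)
        have 2: "a \<cdot>\<^sub>v ?y = R *\<^sub>v (a \<cdot>\<^sub>v x)"
          using x R(1) by (simp add: mult_mat_vec)
        show ?thesis
          unfolding 1 2 using RR[of "M *\<^sub>v x"] RR[of "a \<cdot>\<^sub>v x"] M(1) x
          by (metis mult_mat_vec_carrier smult_carrier_vec)
      qed
      \<comment> \<open>The one by one block multiplies by \<open>a\<close>, so the first coordinate
        of \<open>?y\<close> is unconstrained; this is the extra dimension of the
        eigenspace.\<close>
      also have "\<dots> \<longleftrightarrow> B' *\<^sub>v q = a \<cdot>\<^sub>v q"
      proof -
        have "B *\<^sub>v ?y = (?A *\<^sub>v p) @\<^sub>v (B' *\<^sub>v q)"
          unfolding y Bblock by (rule block_diag_mult_vec) (use B' pq in auto)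
        moreover have "?A *\<^sub>v p = a \<cdot>\<^sub>v p"
          using pq by (intro eq_vecI) (auto simp: scalar_prod_def)
        moreover have "a \<cdot>\<^sub>v ?y = (a \<cdot>\<^sub>v p) @\<^sub>v (a \<cdot>\<^sub>v q)"
          unfolding y by (intro eq_vecI) auto
        ultimately show ?thesis
          using pq append_vec_eq[of "a \<cdot>\<^sub>v p" 1 "a \<cdot>\<^sub>v p"] by simp
      qed
      also have "\<dots> \<longleftrightarrow> (\<exists>c\<in>carrier_vec m. q = Q' *\<^sub>v c)"
        by (rule Q'(3)[OF pq(2)])
      also have "\<dots> \<longleftrightarrow> (\<exists>c\<in>carrier_vec (1 + m). ?y = D *\<^sub>v c)"
      proof
        assume "\<exists>c\<in>carrier_vec m. q = Q' *\<^sub>v c"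
        then obtain c where c: "c \<in> carrier_vec m" "q = Q' *\<^sub>v c" by blast
        have "D *\<^sub>v (p @\<^sub>v c) = (1\<^sub>m 1 *\<^sub>v p) @\<^sub>v (Q' *\<^sub>v c)"
          unfolding D_def by (rule block_diag_mult_vec) (use Q' c pq in auto)
        hence "?y = D *\<^sub>v (p @\<^sub>v c)"
          using pq c y by simp
        thus "\<exists>c\<in>carrier_vec (1 + m). ?y = D *\<^sub>v c"
          using pq(1) c(1) append_carrier_vec by blast
      next
        assume "\<exists>c\<in>carrier_vec (1 + m). ?y = D *\<^sub>v c"
        then obtain c where c: "c \<in> carrier_vec (1 + m)" "?y = D *\<^sub>v c" by blast
        define c1 c2 where "c1 = vec_first c 1" and "c2 = vec_last c m"
        have c12: "c1 \<in> carrier_vec 1" "c2 \<in> carrier_vec m"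
          by (simp_all add: c1_def c2_def)
        have "c = c1 @\<^sub>v c2"
          unfolding c1_def c2_def using c(1) by simp
        moreover have "D *\<^sub>v (c1 @\<^sub>v c2) = (1\<^sub>m 1 *\<^sub>v c1) @\<^sub>v (Q' *\<^sub>v c2)"
          unfolding D_def by (rule block_diag_mult_vec) (use Q' c12 in auto)
        ultimately have "p @\<^sub>v q = c1 @\<^sub>v (Q' *\<^sub>v c2)"
          using c(2) c12 y by simp
        hence "q = Q' *\<^sub>v c2"
          using append_vec_eq[OF pq(1) c12(1)] by blast
        thus "\<exists>c\<in>carrier_vec m. q = Q' *\<^sub>v c"
          using c12 by blast
      qed
      also have "\<dots> \<longleftrightarrow> (\<exists>c\<in>carrier_vec (1 + m). x = Q *\<^sub>v c)"
      proof (rule bex_cong[OF refl])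
        fix c :: "real Matrix.vec" assume c: "c \<in> carrier_vec (1 + m)"
        hence "D *\<^sub>v c \<in> carrier_vec ?N" using D by simp
        thus "?y = D *\<^sub>v c \<longleftrightarrow> x = Q *\<^sub>v c"
          unfolding Qmul[OF c] using RR x by metis
      qed
      finally show ?thesis .
    qed
    thus ?thesis
      unfolding mult using Q QQ by blast
  qed
qed

text \<open>The certificate condition speaks about all orthonormal eigenbases, so an argument that
  starts from it must first have one.\<close>

lemma orthonormal_eigenbasis_exists:
  fixes M :: "real Matrix.mat"
  assumes M: "M \<in> carrier_mat N N" "transpose_mat M = M"
  shows "\<exists>Q. orthonormal_eigenbasis M a Q"
proof -
  let ?m = "eigen_multiplicity M a"
  obtain Q where Q: "Q \<in> carrier_mat N ?m" "transpose_mat Q * Q = 1\<^sub>m ?m"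
    and iff: "\<forall>v\<in>carrier_vec N. M *\<^sub>v v = a \<cdot>\<^sub>v v \<longleftrightarrow> (\<exists>c\<in>carrier_vec ?m. v = Q *\<^sub>v c)"
    using symmetric_eigenbasis[OF M] by blast
  have "vec_space.col_space N Q = eigenspace M a"
    unfolding vec_space.col_space_eq[OF Q(1)] eigenspace_def using Q M iff by auto
  thus ?thesis
    using Q M unfolding orthonormal_eigenbasis_def by auto
qed

section \<open>Dual certificates\<close>

lemma unit_proj_carrier: "unit_proj N k \<in> carrier_mat N N"
  unfolding unit_proj_def by (rule mult_carrier_mat[of _ N 1]) auto

lemma quadratic_unit_proj:
  assumes v: "v \<in> carrier_vec N" and k: "k < N"
  shows "v \<bullet> (unit_proj N k *\<^sub>v v) = (v $ k)\<^sup>2"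
proof -
  have "unit_proj N k $$ (i, j) = (if i = k then if j = k then 1 else 0 else 0)"
    if "i < N" "j < N" for i j
    using that k by (simp add: unit_proj_def scalar_prod_def mat_of_cols_def mat_of_rows_def)
  hence "v \<bullet> (unit_proj N k *\<^sub>v v)
      = (\<Sum>i = 0..<N. \<Sum>j = 0..<N. (if i = k then if j = k then 1 else 0 else 0) * v $ i * v $ j)"
    unfolding quadratic_eq_qform[OF unit_proj_carrier v] qform_def by simp
  also have "\<dots> = (\<Sum>i = 0..<N. if i = k then v $ k * v $ k else 0)"
    by (rule sum.cong) (use k in \<open>auto simp: if_distrib[of "\<lambda>x. x * _"] cong: if_cong\<close>)
  finally show ?thesis
    using k by (simp add: power2_eq_square)
qed

text \<open>The direction in which \<open>real_shifted A y\<close> moves when \<open>y $ k\<close>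
  changes; its quadratic form is the squared modulus of one complex coordinate.\<close>

definition pair_proj :: "nat \<Rightarrow> nat \<Rightarrow> real Matrix.mat" where
  "pair_proj n k = unit_proj (2 * n) k + unit_proj (2 * n) (n + k)"

lemma pair_proj_carrier: "pair_proj n k \<in> carrier_mat (2 * n) (2 * n)"
  by (simp add: pair_proj_def unit_proj_carrier)

lemma quadratic_pair_proj:
  assumes v: "v \<in> carrier_vec (2 * n)" and k: "k < n"
  shows "v \<bullet> (pair_proj n k *\<^sub>v v) = (v $ k)\<^sup>2 + (v $ (n + k))\<^sup>2"
proof -
  have "v \<bullet> (pair_proj n k *\<^sub>v v)
      = v \<bullet> (unit_proj (2 * n) k *\<^sub>v v) + v \<bullet> (unit_proj (2 * n) (n + k) *\<^sub>v v)"
    unfolding pair_proj_def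
    using v unit_proj_carrier[of "2 * n"] mult_mat_vec_carrier[OF unit_proj_carrier v]
    by (simp add: add_mult_distrib_mat_vec[of _ "2 * n" "2 * n"] scalar_prod_add_distrib[of _ "2 * n"])
  thus ?thesis
    using v k by (simp add: quadratic_unit_proj)
qed

text \<open>These projections add up to the identity. Summing the balance equations over
  \<open>k\<close> therefore compares the traces of \<open>X\<close> and \<open>Y\<close>.\<close>

lemma sum_quadratic_pair_proj:
  assumes v: "v \<in> carrier_vec (2 * n)"
  shows "(\<Sum>k<n. v \<bullet> (pair_proj n k *\<^sub>v v)) = v \<bullet> v"
proof -
  define p q where "p = vec_first v n" and "q = vec_last v n"
  have pq: "p \<in> carrier_vec n" "q \<in> carrier_vec n" "v = p @\<^sub>v q"
    using v by (simp_all add: p_def q_def mult_2)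
  have "(\<Sum>k<n. v \<bullet> (pair_proj n k *\<^sub>v v)) = (\<Sum>k = 0..<n. (v $ k)\<^sup>2 + (v $ (n + k))\<^sup>2)"
    by (simp add: quadratic_pair_proj[OF v] lessThan_atLeast0)
  also have "\<dots> = (\<Sum>k = 0..<n. p $ k * p $ k) + (\<Sum>k = 0..<n. q $ k * q $ k)"
    unfolding sum.distrib[symmetric]
    by (rule sum.cong) (use pq in \<open>auto simp: power2_eq_square\<close>)
  also have "\<dots> = v \<bullet> v"
    unfolding pq(3) scalar_prod_append[OF pq(1,2,1,2)] using pq(1,2) by (simp add: scalar_prod_def)
  finally show ?thesis .
qed

lemma quadratic_real_shifted:
  assumes A: "A \<in> carrier_mat n n" and y: "y \<in> carrier_vec n" and v: "v \<in> carrier_vec (2 * n)"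
  shows "v \<bullet> (real_shifted A y *\<^sub>v v)
    = v \<bullet> (real_rep A *\<^sub>v v) + (\<Sum>k<n. y $ k * (v \<bullet> (pair_proj n k *\<^sub>v v)))"
proof -
  define p q where "p = vec_first v n" and "q = vec_last v n"
  have pq: "p \<in> carrier_vec n" "q \<in> carrier_vec n" "v = p @\<^sub>v q"
    using v by (simp_all add: p_def q_def mult_2)
  have D: "Diag y \<in> carrier_mat n n"
    using y by (simp add: Diag_def)
  let ?D = "four_block_mat (Diag y) (0\<^sub>m n n) (0\<^sub>m n n) (Diag y)"
  have D2: "?D \<in> carrier_mat (2 * n) (2 * n)"
    using D by (simp add: mult_2)
  have Dmul: "u \<bullet> (Diag y *\<^sub>v u) = (\<Sum>k = 0..<n. y $ k * (u $ k * u $ k))"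
    if u: "u \<in> carrier_vec n" for u
  proof -
    have "u \<bullet> (Diag y *\<^sub>v u) = (\<Sum>i = 0..<n. \<Sum>j = 0..<n. Diag y $$ (i, j) * u $ i * u $ j)"
      unfolding quadratic_eq_qform[OF D u] qform_def ..
    also have "\<dots> = (\<Sum>i = 0..<n. \<Sum>j = 0..<n. if j = i then y $ i * (u $ i * u $ i) else 0)"
      by (intro sum.cong refl) (use y in \<open>auto simp: Diag_def mat_diag_def\<close>)
    finally show ?thesis by simp
  qed
  have "real_shifted A y = real_rep A + ?D"
    using y by (simp add: real_shifted_def real_rep_def Let_def)
  hence "v \<bullet> (real_shifted A y *\<^sub>v v) = v \<bullet> (real_rep A *\<^sub>v v) + v \<bullet> (?D *\<^sub>v v)"
    using v D2 real_rep_carrier[OF A]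
    by (simp add: add_mult_distrib_mat_vec[of _ "2 * n" "2 * n"] scalar_prod_add_distrib[of _ "2 * n"])
  also have "v \<bullet> (?D *\<^sub>v v) = p \<bullet> (Diag y *\<^sub>v p) + q \<bullet> (Diag y *\<^sub>v q)"
    unfolding pq(3) block_diag_mult_vec[OF D D pq(1,2)]
    by (rule scalar_prod_append) (use pq D in auto)
  also have "\<dots> = (\<Sum>k = 0..<n. y $ k * (v \<bullet> (pair_proj n k *\<^sub>v v)))"
    unfolding Dmul[OF pq(1)] Dmul[OF pq(2)] sum.distrib[symmetric]
  proof (rule sum.cong[OF refl])
    fix k assume "k \<in> {0..<n}"
    hence "k < n" by simp
    thus "y $ k * (p $ k * p $ k) + y $ k * (q $ k * q $ k) = y $ k * (v \<bullet> (pair_proj n k *\<^sub>v v))"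
      unfolding quadratic_pair_proj[OF v \<open>k < n\<close>] using pq
      by (simp add: power2_eq_square distrib_left)
  qed
  finally show ?thesis
    by (simp add: lessThan_atLeast0)
qed

section \<open>Traces of Gram products\<close>

lemma mat_trace_mult_commute:
  fixes A :: "real Matrix.mat"
  assumes "A \<in> carrier_mat m k" "B \<in> carrier_mat k m"
  shows "mat_trace (A * B) = mat_trace (B * A)"
proof -
  have "mat_trace (A * B) = (\<Sum>i = 0..<m. \<Sum>j = 0..<k. A $$ (i, j) * B $$ (j, i))"
    using assms by (simp add: mat_trace_def scalar_prod_def lessThan_atLeast0)
  also have "\<dots> = (\<Sum>j = 0..<k. \<Sum>i = 0..<m. A $$ (i, j) * B $$ (j, i))"
    by (rule sum.swap)
  also have "\<dots> = mat_trace (B * A)"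
    using assms by (simp add: mat_trace_def scalar_prod_def lessThan_atLeast0 mult.commute)
  finally show ?thesis .
qed

text \<open>By cyclicity the expression is the trace of \<open>F^t E F\<close> with
  \<open>F = Q * G\<close>. The columns of \<open>F\<close> are the rank one factors of
  \<open>Q U Q^t\<close> when \<open>U = G G^t\<close>.\<close>

lemma mat_trace_gram:
  fixes Q :: "real Matrix.mat"
  assumes Q: "Q \<in> carrier_mat N t" and G: "G \<in> carrier_mat t s" and E: "E \<in> carrier_mat N N"
  shows "mat_trace (transpose_mat Q * E * Q * (G * transpose_mat G))
    = (\<Sum>r<s. col (Q * G) r \<bullet> (E *\<^sub>v col (Q * G) r))"
proof -
  let ?F = "Q * G"
  have F: "?F \<in> carrier_mat N s" using Q G by simp
  have "transpose_mat Q * E * Q * (G * transpose_mat G)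
      = transpose_mat Q * E * (Q * (G * transpose_mat G))"
    by (rule assoc_mult_mat[of _ t N _ t _ t]) (use Q G E in auto)
  also have "Q * (G * transpose_mat G) = ?F * transpose_mat G"
    by (rule assoc_mult_mat[of _ N t _ s _ t, symmetric]) (use Q G in auto)
  also have "transpose_mat Q * E * (?F * transpose_mat G) = transpose_mat Q * E * ?F * transpose_mat G"
    by (rule assoc_mult_mat[of _ t N _ s _ t, symmetric]) (use Q G E F in auto)
  also have "transpose_mat Q * E * ?F = transpose_mat Q * (E * ?F)"
    by (rule assoc_mult_mat[of _ t N _ N _ s]) (use Q E F in auto)
  finally have 1: "transpose_mat Q * E * Q * (G * transpose_mat G)
      = (transpose_mat Q * (E * ?F)) * transpose_mat G" .
  have 2: "transpose_mat G * (transpose_mat Q * (E * ?F)) = transpose_mat ?F * (E * ?F)"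
    using Q G E F by (simp add: transpose_mult[of Q N t G s] assoc_mult_mat[of _ s t _ N _ s])
  have "mat_trace (transpose_mat Q * E * Q * (G * transpose_mat G)) = mat_trace (transpose_mat ?F * (E * ?F))"
    unfolding 1 2[symmetric] by (rule mat_trace_mult_commute[of _ t s]) (use Q G E in auto)
  also have "\<dots> = (\<Sum>r<s. col ?F r \<bullet> (E *\<^sub>v col ?F r))"
    unfolding mat_trace_def using F E
    by (intro sum.cong) (auto simp del: col_mult2 simp: col_mult2[OF E F])
  finally show ?thesis .
qed

text \<open>The case of the identity in \<open>mat_trace_gram\<close>, where orthonormality cancels
  \<open>Q\<close>: passing from \<open>U\<close> to \<open>Q U Q^t\<close> preserves the
  trace.\<close>

lemma mat_trace_gram_orthonormal:
  fixes Q :: "real Matrix.mat"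
  assumes Q: "Q \<in> carrier_mat N t" "transpose_mat Q * Q = 1\<^sub>m t" and G: "G \<in> carrier_mat t s"
  shows "mat_trace (G * transpose_mat G) = (\<Sum>r<s. col (Q * G) r \<bullet> col (Q * G) r)"
proof -
  have "transpose_mat Q * 1\<^sub>m N * Q * (G * transpose_mat G) = G * transpose_mat G"
    using Q G by (simp add: left_mult_one_mat[of _ t t])
  moreover have "1\<^sub>m N *\<^sub>v col (Q * G) r = col (Q * G) r" if "r < s" for r
    using Q(1) G that by (intro one_mult_mat_vec) auto
  ultimately show ?thesis
    using mat_trace_gram[OF Q(1) G one_carrier_mat] by simp
qed

lemma psd_mat_gram:
  assumes "psd_mat m U"
  shows "\<exists>G\<in>carrier_mat m m. U = G * transpose_mat G"
proof -
  have U: "U \<in> carrier_mat m m" "transpose_mat U = U"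
    and nonneg: "\<And>v. v \<in> carrier_vec m \<Longrightarrow> 0 \<le> v \<bullet> (U *\<^sub>v v)"
    using assms by (auto simp: psd_mat_def)
  have "U $$ (i, j) = U $$ (j, i)" if "i < m" "j < m" for i j
    using that U(1) by (subst U(2)[symmetric]) simp
  moreover have "0 \<le> qform {0..<m} (\<lambda>i j. U $$ (i, j)) v" for v
    using nonneg[of "Matrix.vec m v"] quadratic_eq_qform[OF U(1), of "Matrix.vec m v"]
    by (simp add: qform_def)
  ultimately obtain L where L: "\<forall>i\<in>{0..<m}. \<forall>j\<in>{0..<m}. U $$ (i, j) = (\<Sum>r\<in>{0..<m}. L r i * L r j)"
    using psd_gram[of "{0..<m}" "\<lambda>i j. U $$ (i, j)"] by auto
  let ?G = "Matrix.mat m m (\<lambda>(i, r). L r i)"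
  have "U = ?G * transpose_mat ?G"
    by (rule eq_matI) (use U L in \<open>auto simp: scalar_prod_def\<close>)
  thus ?thesis by (intro bexI[of _ ?G]) auto
qed

lemma psd_mat_gram_self:
  assumes G: "G \<in> carrier_mat m s"
  shows "psd_mat m (G * transpose_mat G)"
proof -
  have "0 \<le> v \<bullet> ((G * transpose_mat G) *\<^sub>v v)" if v: "v \<in> carrier_vec m" for v
  proof -
    have "v \<bullet> ((G * transpose_mat G) *\<^sub>v v) = v \<bullet> (G *\<^sub>v (transpose_mat G *\<^sub>v v))"
      using G v by simp
    also have "\<dots> = (transpose_mat G *\<^sub>v v) \<bullet> (transpose_mat G *\<^sub>v v)"
      by (rule transpose_vec_mult_scalar[symmetric]) (use G v in auto)
    also have "\<dots> \<ge> 0"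
      unfolding euclid_norm_power2_real[symmetric] by simp
    finally show ?thesis .
  qed
  thus ?thesis
    using G by (simp add: psd_mat_def transpose_mult[of G m s])
qed


section \<open>Weak and strong duality at the point \<open>x\<close>\<close>

lemma real_shifted_carrier:
  "A \<in> carrier_mat n n \<Longrightarrow> y \<in> carrier_vec n \<Longrightarrow> real_shifted A y \<in> carrier_mat (2 * n) (2 * n)"
  by (simp only: real_shifted_eq_real_rep real_rep_carrier shifted_carrier)

lemma real_shifted_symmetric:
  assumes "hermitian_mat A" "A \<in> carrier_mat n n" "y \<in> carrier_vec n"
  shows "transpose_mat (real_shifted A y) = real_shifted A y"
  unfolding real_shifted_eq_real_rep[OF assms(2,3)]
  by (rule real_rep_symmetric[OF shifted_carrier[OF assms(2,3)]]) (rule shifted_hermitian[OF assms])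

lemma abs_eigenvalue_le_spectral_norm:
  fixes M :: "real Matrix.mat"
  assumes M: "M \<in> carrier_mat N N" and "eigenvalue M b"
  shows "\<bar>b\<bar> \<le> spectral_norm M"
proof -
  obtain v where v: "v \<in> carrier_vec N" "v \<noteq> 0\<^sub>v N" "M *\<^sub>v v = b \<cdot>\<^sub>v v"
    using assms by (auto simp: eigenvalue_def eigenvector_def)
  have "\<bar>b\<bar> * euclid_norm v \<le> spectral_norm M * euclid_norm v"
    using euclid_norm_mult_mat_vec_le[of v M] v M by (simp add: euclid_norm_smult)
  moreover have "0 < euclid_norm v"
    using v(1,2) euclid_norm_eq_0_iff[of v] euclid_norm_nonneg[of v] by auto
  ultimately show ?thesis by simp
qed

text \<open>Relative to the base point \<open>x\<close> the change is linear in
  \<open>y - x\<close>, and its coefficients are exactly the sums that occur in the balance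
  equations.\<close>

lemma sum_quadratic_real_shifted:
  fixes s :: nat
  assumes A: "A \<in> carrier_mat n n" and x: "x \<in> carrier_vec n" and y: "y \<in> carrier_vec n"
    and F: "\<And>r. r < s \<Longrightarrow> f r \<in> carrier_vec (2 * n)"
  shows "(\<Sum>r<s. f r \<bullet> (real_shifted A y *\<^sub>v f r)) = (\<Sum>r<s. f r \<bullet> (real_shifted A x *\<^sub>v f r))
    + (\<Sum>k<n. (y $ k - x $ k) * (\<Sum>r<s. f r \<bullet> (pair_proj n k *\<^sub>v f r)))"
proof -
  have "(\<Sum>k<n. (y $ k - x $ k) * (\<Sum>r<s. f r \<bullet> (pair_proj n k *\<^sub>v f r)))
      = (\<Sum>r<s. \<Sum>k<n. (y $ k - x $ k) * (f r \<bullet> (pair_proj n k *\<^sub>v f r)))"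
    unfolding sum_distrib_left by (rule sum.swap)
  moreover have "f r \<bullet> (real_shifted A y *\<^sub>v f r) = f r \<bullet> (real_shifted A x *\<^sub>v f r)
      + (\<Sum>k<n. (y $ k - x $ k) * (f r \<bullet> (pair_proj n k *\<^sub>v f r)))" if "r < s" for r
    unfolding quadratic_real_shifted[OF A x F[OF that]] quadratic_real_shifted[OF A y F[OF that]]
    by (simp add: left_diff_distrib sum_subtractf)
  ultimately show ?thesis
    by (simp add: sum.distrib)
qed

text \<open>Weak duality, with \<open>X\<close> and \<open>Y\<close> given by their rank one factors
  \<open>f r\<close> and \<open>g r\<close>.\<close>

lemma certificate_le_spectral_norm:
  fixes s t :: nat
  assumes A: "A \<in> carrier_mat n n" and x: "x \<in> carrier_vec n" and y: "y \<in> carrier_vec n"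
    and f: "\<And>r. r < s \<Longrightarrow> f r \<in> carrier_vec (2 * n)"
      "\<And>r. r < s \<Longrightarrow> real_shifted A x *\<^sub>v f r = w \<cdot>\<^sub>v f r"
    and g: "\<And>r. r < t \<Longrightarrow> g r \<in> carrier_vec (2 * n)"
      "\<And>r. r < t \<Longrightarrow> real_shifted A x *\<^sub>v g r = (- w) \<cdot>\<^sub>v g r"
    and norm1: "(\<Sum>r<s. f r \<bullet> f r) + (\<Sum>r<t. g r \<bullet> g r) = 1"
    and bal: "\<And>k. k < n \<Longrightarrow> (\<Sum>r<s. f r \<bullet> (pair_proj n k *\<^sub>v f r)) = (\<Sum>r<t. g r \<bullet> (pair_proj n k *\<^sub>v g r))"
  shows "w \<le> spectral_norm (real_shifted A y)"
proof -
  let ?M = "real_shifted A x" and ?M' = "real_shifted A y"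
  have M': "?M' \<in> carrier_mat (2 * n) (2 * n)"
    by (rule real_shifted_carrier[OF A y])
  have "(\<Sum>r<s. f r \<bullet> (?M *\<^sub>v f r)) = w * (\<Sum>r<s. f r \<bullet> f r)"
    unfolding sum_distrib_left using f by (intro sum.cong) auto
  moreover have "(\<Sum>r<t. g r \<bullet> (?M *\<^sub>v g r)) = - w * (\<Sum>r<t. g r \<bullet> g r)"
    unfolding sum_distrib_left using g by (intro sum.cong) auto
  ultimately have "w = (\<Sum>r<s. f r \<bullet> (?M *\<^sub>v f r)) - (\<Sum>r<t. g r \<bullet> (?M *\<^sub>v g r))"
    using arg_cong[OF norm1, of "\<lambda>z. w * z"] by (simp add: distrib_left)
  \<comment> \<open>By \<open>bal\<close>, passing from \<open>x\<close> to \<open>y\<close> changes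
    both sums by the same amount.\<close>
  also have "\<dots> = (\<Sum>r<s. f r \<bullet> (?M' *\<^sub>v f r)) - (\<Sum>r<t. g r \<bullet> (?M' *\<^sub>v g r))"
    using sum_quadratic_real_shifted[OF A x y, where s = s and f = f, OF f(1)]
      sum_quadratic_real_shifted[OF A x y, where s = t and f = g, OF g(1)] bal
    by simp
  also have "\<dots> \<le> (\<Sum>r<s. spectral_norm ?M' * (f r \<bullet> f r)) + (\<Sum>r<t. spectral_norm ?M' * (g r \<bullet> g r))"
  proof -
    have "(\<Sum>r<s. f r \<bullet> (?M' *\<^sub>v f r)) \<le> (\<Sum>r<s. spectral_norm ?M' * (f r \<bullet> f r))"
      using abs_quadratic_le_spectral_norm[OF M' f(1)] by (intro sum_mono) (simp add: abs_le_iff)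
    moreover have "(\<Sum>r<t. - (g r \<bullet> (?M' *\<^sub>v g r))) \<le> (\<Sum>r<t. spectral_norm ?M' * (g r \<bullet> g r))"
      using abs_quadratic_le_spectral_norm[OF M' g(1)] by (intro sum_mono) (simp add: abs_le_iff)
    ultimately show ?thesis by (simp add: sum_negf)
  qed
  also have "\<dots> = spectral_norm ?M'"
    unfolding sum_distrib_left[symmetric] distrib_left[symmetric] norm1 by simp
  finally show ?thesis .
qed

text \<open>Strong duality: the second alternative in \<open>closest_point_certificate\<close> would
  produce a shift of smaller norm. The columns of \<open>L\<close> and \<open>K\<close> are the rank
  one factors of \<open>X\<close> and \<open>Y\<close>.\<close>

lemma minimal_certificate:
  assumes n: "0 < n" and A: "A \<in> carrier_mat n n" "hermitian_mat A" and x: "x \<in> carrier_vec n"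
    and min: "\<And>y. y \<in> carrier_vec n \<Longrightarrow> spectral_norm (real_shifted A x) \<le> spectral_norm (real_shifted A y)"
  defines "N \<equiv> 2 * n" and "M \<equiv> real_shifted A x" and "w \<equiv> spectral_norm (real_shifted A x)"
  shows "\<exists>L\<in>carrier_mat N N. \<exists>K\<in>carrier_mat N N.
    (\<Sum>r<N. col L r \<bullet> col L r) + (\<Sum>r<N. col K r \<bullet> col K r) = 1 \<and>
    (\<forall>k<n. (\<Sum>r<N. col L r \<bullet> (pair_proj n k *\<^sub>v col L r)) = (\<Sum>r<N. col K r \<bullet> (pair_proj n k *\<^sub>v col K r))) \<and>
    (\<forall>r<N. M *\<^sub>v col L r = w \<cdot>\<^sub>v col L r) \<and> (\<forall>r<N. M *\<^sub>v col K r = (- w) \<cdot>\<^sub>v col K r)"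
proof -
  have M: "M \<in> carrier_mat N N"
    unfolding M_def N_def by (rule real_shifted_carrier[OF A(1) x])
  have w: "w = spectral_norm M" "0 \<le> w"
    by (simp_all add: w_def M_def spectral_norm_nonneg)
  \<comment> \<open>Coordinates below \<open>n\<close> encode the balance equations, with target
    \<open>0\<close>; the extra coordinate \<open>n\<close> is the pairing with \<open>M\<close>,
    with target \<open>w\<close>.\<close>
  define P where "P k = (if k < n then (\<lambda>i j. pair_proj n k $$ (i, j)) else (\<lambda>i j. M $$ (i, j)))" for k
  define \<tau> where "\<tau> k = (if k < n then 0 else w)" for k
  let ?I = "{0..<N}"
  have Ppair: "qform ?I (P k) u = Matrix.vec N u \<bullet> (pair_proj n k *\<^sub>v Matrix.vec N u)" if "k < n" for k u
    using that pair_proj_carrier[of n k]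
    by (simp add: quadratic_eq_qform[of _ N] P_def qform_def N_def)
  have Pn: "qform ?I (P n) u = Matrix.vec N u \<bullet> (M *\<^sub>v Matrix.vec N u)" for u
    using M by (simp add: quadratic_eq_qform[of _ N] P_def qform_def)
  have sq: "(\<Sum>i\<in>?I. (u i)\<^sup>2) = Matrix.vec N u \<bullet> Matrix.vec N u" for u :: "nat \<Rightarrow> real"
    by (simp add: scalar_prod_def power2_eq_square)
  have "?I \<noteq> {}" using n by (simp add: N_def)
  from closest_point_certificate[OF finite_atLeastLessThan this finite_atMost, of n P \<tau>]
  show ?thesis
  proof (elim disjE exE conjE)
    fix \<rho> :: "nat \<Rightarrow> real"
    let ?s = "\<Sum>k\<le>n. (\<rho> k)\<^sup>2"
    assume pos: "0 < ?s" and bound: "\<forall>v. \<bar>\<Sum>k\<le>n. \<rho> k * qform ?I (P k) v\<bar>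
         \<le> ((\<Sum>k\<le>n. \<rho> k * \<tau> k) - ?s) * (\<Sum>i\<in>?I. (v i)\<^sup>2)"
    have \<tau>: "(\<Sum>k\<le>n. \<rho> k * \<tau> k) = \<rho> n * w"
      by (simp add: \<tau>_def flip: lessThan_Suc_atMost)
    have bound': "\<bar>(\<Sum>k<n. \<rho> k * (v \<bullet> (pair_proj n k *\<^sub>v v))) + \<rho> n * (v \<bullet> (M *\<^sub>v v))\<bar>
        \<le> (\<rho> n * w - ?s) * (v \<bullet> v)" if v: "v \<in> carrier_vec N" for v
    proof -
      have "Matrix.vec N (\<lambda>i. v $ i) = v" using v by auto
      thus ?thesis
        using bound[unfolded \<tau>, rule_format, of "\<lambda>i. v $ i"]
        by (simp add: sq Ppair Pn flip: lessThan_Suc_atMost)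
    qed
    \<comment> \<open>A single unit vector shows that the factor in \<open>bound'\<close> is
      nonnegative; as \<open>?s\<close> is positive and \<open>w\<close> is not negative,
      \<open>\<rho> n\<close> is positive and may be divided by.\<close>
    have "unit_vec N 0 \<bullet> (unit_vec N 0 :: real Matrix.vec) = 1"
      using n by (simp add: N_def)
    hence "0 \<le> \<rho> n * w - ?s"
      using bound'[of "unit_vec N 0"] by simp
    hence \<rho>n: "0 < \<rho> n"
      using pos w(2) by (metis diff_ge_0_iff_ge less_le_trans mult_nonpos_nonneg not_le)
    \<comment> \<open>Divided by \<open>\<rho> n\<close>, the separating functional becomes the
      quadratic form of \<open>M\<close> shifted by \<open>\<rho> k / \<rho> n\<close>, so that the
      norm is at most \<open>w - ?s / \<rho> n\<close>.\<close>
    define y where "y = Matrix.vec n (\<lambda>k. x $ k + \<rho> k / \<rho> n)"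
    have y: "y \<in> carrier_vec n" by (simp add: y_def)
    have "spectral_norm (real_shifted A y) \<le> (\<rho> n * w - ?s) / \<rho> n"
    proof (rule spectral_norm_le_quadratic[OF real_shifted_carrier[OF A(1) y] real_shifted_symmetric[OF A(2,1) y]])
      show "0 \<le> (\<rho> n * w - ?s) / \<rho> n"
        using \<open>0 \<le> \<rho> n * w - ?s\<close> \<rho>n by simp
      fix v :: "real Matrix.vec" assume v: "v \<in> carrier_vec (2 * n)"
      have "v \<bullet> (real_shifted A y *\<^sub>v v)
          = v \<bullet> (M *\<^sub>v v) + (\<Sum>k<n. (y $ k - x $ k) * (v \<bullet> (pair_proj n k *\<^sub>v v)))"
        using sum_quadratic_real_shifted[OF A(1) x y, where s = 1 and f = "\<lambda>_. v"] v by (simp add: M_def)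
      also have "(\<Sum>k<n. (y $ k - x $ k) * (v \<bullet> (pair_proj n k *\<^sub>v v)))
          = (\<Sum>k<n. \<rho> k * (v \<bullet> (pair_proj n k *\<^sub>v v))) / \<rho> n"
        unfolding sum_divide_distrib by (rule sum.cong) (auto simp: y_def)
      finally have "v \<bullet> (real_shifted A y *\<^sub>v v)
          = ((\<Sum>k<n. \<rho> k * (v \<bullet> (pair_proj n k *\<^sub>v v))) + \<rho> n * (v \<bullet> (M *\<^sub>v v))) / \<rho> n"
        using \<rho>n by (simp add: add_divide_distrib)
      thus "\<bar>v \<bullet> (real_shifted A y *\<^sub>v v)\<bar> \<le> (\<rho> n * w - ?s) / \<rho> n * (v \<bullet> v)"
        using bound'[of v] v \<rho>n by (simp add: N_def abs_divide divide_right_mono)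
    qed
    also have "\<dots> < w"
      using pos \<rho>n by (simp add: pos_divide_less_eq mult.commute)
    finally show ?thesis
      using min[OF y] by (simp add: w_def)
  next
    fix L K :: "nat \<Rightarrow> nat \<Rightarrow> real"
    assume norm1: "(\<Sum>r\<in>?I. \<Sum>i\<in>?I. (L r i)\<^sup>2) + (\<Sum>r\<in>?I. \<Sum>i\<in>?I. (K r i)\<^sup>2) = 1"
      and eq: "\<forall>k\<in>{..n}. (\<Sum>r\<in>?I. qform ?I (P k) (L r)) - (\<Sum>r\<in>?I. qform ?I (P k) (K r)) = \<tau> k"
    define F G where "F = Matrix.mat N N (\<lambda>(i, r). L r i)" and "G = Matrix.mat N N (\<lambda>(i, r). K r i)"
    have F: "F \<in> carrier_mat N N" and G: "G \<in> carrier_mat N N"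
      by (simp_all add: F_def G_def)
    have cF: "col F r = Matrix.vec N (L r)" and cG: "col G r = Matrix.vec N (K r)" if "r < N" for r
      using that by (auto simp: F_def G_def)
    have car: "col F r \<in> carrier_vec N" "col G r \<in> carrier_vec N" for r
      using F G by auto
    have n1: "(\<Sum>r<N. col F r \<bullet> col F r) + (\<Sum>r<N. col G r \<bullet> col G r) = 1"
      using norm1 unfolding sq by (simp add: cF cG lessThan_atLeast0)
    have bal: "(\<Sum>r<N. col F r \<bullet> (pair_proj n k *\<^sub>v col F r)) = (\<Sum>r<N. col G r \<bullet> (pair_proj n k *\<^sub>v col G r))"
      if "k < n" for k
      using eq[rule_format, of k] that by (simp add: cF cG lessThan_atLeast0 Ppair \<tau>_def)
    have "(\<Sum>r<N. col F r \<bullet> (M *\<^sub>v col F r)) - (\<Sum>r<N. col G r \<bullet> (M *\<^sub>v col G r)) = w"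
      using eq[rule_format, of n] by (simp add: cF cG lessThan_atLeast0 Pn \<tau>_def)
    \<comment> \<open>The slacks in \<open>tr (X M) \<le> w tr X\<close> and
      \<open>- tr (Y M) \<le> w tr Y\<close> add up to zero, so the nonnegative contribution of
      every single column vanishes.\<close>
    hence "(\<Sum>r<N. (w * (col F r \<bullet> col F r) - col F r \<bullet> (M *\<^sub>v col F r))
        + (w * (col G r \<bullet> col G r) + col G r \<bullet> (M *\<^sub>v col G r))) = 0"
      using arg_cong[OF n1, of "\<lambda>z. w * z"]
      by (simp add: sum.distrib sum_subtractf distrib_left flip: sum_distrib_left)
    moreover have nonneg: "0 \<le> w * (col F r \<bullet> col F r) - col F r \<bullet> (M *\<^sub>v col F r)"
      "0 \<le> w * (col G r \<bullet> col G r) + col G r \<bullet> (M *\<^sub>v col G r)" for r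
      using abs_quadratic_le_spectral_norm[OF M car(1)[of r]] abs_quadratic_le_spectral_norm[OF M car(2)[of r]]
      by (simp_all add: w(1) abs_le_iff)
    ultimately have zero: "\<forall>r\<in>{..<N}. (w * (col F r \<bullet> col F r) - col F r \<bullet> (M *\<^sub>v col F r))
        + (w * (col G r \<bullet> col G r) + col G r \<bullet> (M *\<^sub>v col G r)) = 0"
      by (subst (asm) sum_nonneg_eq_0_iff) (auto intro: add_nonneg_nonneg)
    have "M *\<^sub>v col F r = w \<cdot>\<^sub>v col F r \<and> M *\<^sub>v col G r = (- w) \<cdot>\<^sub>v col G r" if "r < N" for r
    proof -
      have "col F r \<bullet> (M *\<^sub>v col F r) = w * (col F r \<bullet> col F r)"
        "col G r \<bullet> (M *\<^sub>v col G r) = - w * (col G r \<bullet> col G r)"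
        using zero[rule_format, of r] nonneg[of r] that by auto
      thus ?thesis
        using eigenvector_if_quadratic_extremal[OF M car(1)[of r], of w]
          eigenvector_if_quadratic_extremal[OF M car(2)[of r], of "- w"] w by auto
    qed
    thus ?thesis
      using F G n1 bal by blast
  qed
qed

text \<open>\<open>Q Q^t\<close> is the orthogonal projection onto the eigenspace: a column of
  \<open>L\<close> has the form \<open>Q *\<^sub>v c\<close>, and orthonormality recovers
  \<open>c\<close> from it.\<close>

lemma orthonormal_eigenbasis_projection:
  fixes M :: "real Matrix.mat"
  assumes M: "M \<in> carrier_mat N N" and Q: "orthonormal_eigenbasis M a Q"
    and L: "L \<in> carrier_mat N s" "\<And>r. r < s \<Longrightarrow> M *\<^sub>v col L r = a \<cdot>\<^sub>v col L r"
  shows "Q * (transpose_mat Q * L) = L"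
proof (rule mat_col_eqI)
  let ?m = "eigen_multiplicity M a"
  have Qc: "Q \<in> carrier_mat N ?m" and QQ: "transpose_mat Q * Q = 1\<^sub>m ?m"
    and space: "vec_space.col_space N Q = eigenspace M a"
    using Q M by (auto simp: orthonormal_eigenbasis_def)
  have QT: "transpose_mat Q \<in> carrier_mat ?m N" using Qc by simp
  fix r assume "r < dim_col L"
  hence r: "r < s" using L by simp
  have cL: "col L r \<in> carrier_vec N" using L by auto
  have "col L r \<in> eigenspace M a"
    unfolding eigenspace_def using M cL L(2)[OF r] by simp
  then obtain c where c: "c \<in> carrier_vec ?m" "Q *\<^sub>v c = col L r"
    unfolding space[symmetric] vec_space.col_space_eq[OF Qc] using Qc by auto
  have "col (Q * (transpose_mat Q * L)) r = Q *\<^sub>v (transpose_mat Q *\<^sub>v (Q *\<^sub>v c))"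
    unfolding col_mult2[OF Qc mult_carrier_mat[OF QT L(1)] r] col_mult2[OF QT L(1) r] c(2) ..
  also have "transpose_mat Q *\<^sub>v (Q *\<^sub>v c) = (transpose_mat Q * Q) *\<^sub>v c"
    by (rule assoc_mult_mat_vec[symmetric]) (use Qc c in auto)
  finally show "col (Q * (transpose_mat Q * L)) r = col L r"
    using QQ c by simp
qed (use assms in \<open>auto simp: orthonormal_eigenbasis_def\<close>)

text \<open>The certificate \<open>L\<close>, \<open>K\<close> is found before any bases are chosen;
  a given pair of bases then only rewrites it in coordinates.\<close>

lemma certificate_if_minimal:
  assumes n: "0 < n" and A: "A \<in> carrier_mat n n" "hermitian_mat A" and x: "x \<in> carrier_vec n"
    and min: "\<And>y. y \<in> carrier_vec n \<Longrightarrow> spectral_norm (real_shifted A x) \<le> spectral_norm (real_shifted A y)"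
  defines "M \<equiv> real_shifted A x" and "w \<equiv> spectral_norm (real_shifted A x)"
  shows "largest_eigenvalue M w \<and> smallest_eigenvalue M (- w) \<and>
    (\<forall>Q\<^sub>1 Q\<^sub>2. orthonormal_eigenbasis M w Q\<^sub>1 \<and> orthonormal_eigenbasis M (- w) Q\<^sub>2 \<longrightarrow>
      (\<exists>U V. psd_mat (eigen_multiplicity M w) U \<and> psd_mat (eigen_multiplicity M (- w)) V \<and>
        mat_trace U + mat_trace V = 1 \<and>
        (\<forall>k<n. mat_trace (transpose_mat Q\<^sub>1 * pair_proj n k * Q\<^sub>1 * U)
           - mat_trace (transpose_mat Q\<^sub>2 * pair_proj n k * Q\<^sub>2 * V) = 0)))"
proof -
  define N where "N = 2 * n"
  have M: "M \<in> carrier_mat N N"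
    unfolding M_def N_def by (rule real_shifted_carrier[OF A(1) x])
  obtain L K where L: "L \<in> carrier_mat N N" and K: "K \<in> carrier_mat N N"
    and norm1: "(\<Sum>r<N. col L r \<bullet> col L r) + (\<Sum>r<N. col K r \<bullet> col K r) = 1"
    and bal: "\<And>k. k < n \<Longrightarrow> (\<Sum>r<N. col L r \<bullet> (pair_proj n k *\<^sub>v col L r))
      = (\<Sum>r<N. col K r \<bullet> (pair_proj n k *\<^sub>v col K r))"
    and eL: "\<And>r. r < N \<Longrightarrow> M *\<^sub>v col L r = w \<cdot>\<^sub>v col L r"
    and eK: "\<And>r. r < N \<Longrightarrow> M *\<^sub>v col K r = (- w) \<cdot>\<^sub>v col K r"
    using minimal_certificate[OF n A x min] unfolding M_def w_def N_def by blast
  have total: "(\<Sum>k<n. \<Sum>r<N. col F r \<bullet> (pair_proj n k *\<^sub>v col F r)) = (\<Sum>r<N. col F r \<bullet> col F r)"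
    if F: "F \<in> carrier_mat N N" for F
  proof -
    have "col F r \<in> carrier_vec (2 * n)" for r
      using F col_dim[of F r] by (simp add: N_def)
    thus ?thesis
      by (subst sum.swap) (simp add: sum_quadratic_pair_proj)
  qed
  \<comment> \<open>Summing the balance equations over \<open>k\<close> gives equal traces, each one
    half; so \<open>L\<close> and \<open>K\<close> both have a nonzero column, and \<open>w\<close>
    and \<open>- w\<close> are both eigenvalues.\<close>
  have "(\<Sum>r<N. col L r \<bullet> col L r) = (\<Sum>r<N. col K r \<bullet> col K r)"
    unfolding total[OF L, symmetric] total[OF K, symmetric] by (rule sum.cong) (simp_all add: bal)
  hence half: "(\<Sum>r<N. col L r \<bullet> col L r) \<noteq> 0" "(\<Sum>r<N. col K r \<bullet> col K r) \<noteq> 0"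
    using norm1 by auto
  have ev: "eigenvalue M a" if F: "F \<in> carrier_mat N N" "(\<Sum>r<N. col F r \<bullet> col F r) \<noteq> 0"
      "\<And>r. r < N \<Longrightarrow> M *\<^sub>v col F r = a \<cdot>\<^sub>v col F r" for F a
  proof -
    obtain r where r: "r < N" "col F r \<bullet> col F r \<noteq> 0"
      using sum.not_neutral_contains_not_neutral[OF F(2)] by auto
    have "col F r \<in> carrier_vec N" using F(1) col_dim[of F r] by simp
    moreover from this have "col F r \<noteq> 0\<^sub>v N" using r(2) by auto
    ultimately show ?thesis
      using F(3)[OF r(1)] M by (auto simp: eigenvalue_def eigenvector_def)
  qed
  have bounds: "\<bar>b\<bar> \<le> w" if "eigenvalue M b" for b
    using abs_eigenvalue_le_spectral_norm[OF M that] by (simp add: w_def M_def)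
  have "largest_eigenvalue M w" "smallest_eigenvalue M (- w)"
    unfolding largest_eigenvalue_def smallest_eigenvalue_def
    using ev[OF L half(1) eL] ev[OF K half(2) eK] by (auto dest!: bounds simp: abs_le_iff)
  moreover have "\<exists>U V. psd_mat (eigen_multiplicity M w) U \<and> psd_mat (eigen_multiplicity M (- w)) V \<and>
        mat_trace U + mat_trace V = 1 \<and>
        (\<forall>k<n. mat_trace (transpose_mat Q\<^sub>1 * pair_proj n k * Q\<^sub>1 * U)
           - mat_trace (transpose_mat Q\<^sub>2 * pair_proj n k * Q\<^sub>2 * V) = 0)"
    if Q: "orthonormal_eigenbasis M w Q\<^sub>1" "orthonormal_eigenbasis M (- w) Q\<^sub>2" for Q\<^sub>1 Q\<^sub>2
  proof -
    define t s where "t = eigen_multiplicity M w" and "s = eigen_multiplicity M (- w)"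
    have Q1: "Q\<^sub>1 \<in> carrier_mat N t" "transpose_mat Q\<^sub>1 * Q\<^sub>1 = 1\<^sub>m t"
      and Q2: "Q\<^sub>2 \<in> carrier_mat N s" "transpose_mat Q\<^sub>2 * Q\<^sub>2 = 1\<^sub>m s"
      using Q M by (auto simp: orthonormal_eigenbasis_def t_def s_def)
    \<comment> \<open>Coordinates of the columns of \<open>L\<close> and \<open>K\<close> in the
      given eigenbases; \<open>U = G G^t\<close> and \<open>V = H H^t\<close> then give back the
      same \<open>X\<close> and \<open>Y\<close>.\<close>
    define G H where "G = transpose_mat Q\<^sub>1 * L" and "H = transpose_mat Q\<^sub>2 * K"
    have G: "G \<in> carrier_mat t N" and H: "H \<in> carrier_mat s N"
      using Q1 Q2 L K by (auto simp: G_def H_def)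
    have QG: "Q\<^sub>1 * G = L" and QH: "Q\<^sub>2 * H = K"
      unfolding G_def H_def
      using orthonormal_eigenbasis_projection[OF M Q(1) L eL] orthonormal_eigenbasis_projection[OF M Q(2) K eK]
      by blast+
    have E: "pair_proj n k \<in> carrier_mat N N" for k
      unfolding N_def by (rule pair_proj_carrier)
    have "mat_trace (G * transpose_mat G) + mat_trace (H * transpose_mat H) = 1"
      unfolding mat_trace_gram_orthonormal[OF Q1 G] mat_trace_gram_orthonormal[OF Q2 H] QG QH
      by (rule norm1)
    moreover have "mat_trace (transpose_mat Q\<^sub>1 * pair_proj n k * Q\<^sub>1 * (G * transpose_mat G))
        - mat_trace (transpose_mat Q\<^sub>2 * pair_proj n k * Q\<^sub>2 * (H * transpose_mat H)) = 0" if "k < n" for k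
      unfolding mat_trace_gram[OF Q1(1) G E] mat_trace_gram[OF Q2(1) H E] QG QH
      using bal[OF that] by simp
    ultimately show ?thesis
      unfolding t_def[symmetric] s_def[symmetric]
      using psd_mat_gram_self[OF G] psd_mat_gram_self[OF H] by blast
  qed
  ultimately show ?thesis by blast
qed

text \<open>All eigenvalues lie between \<open>- w\<close> and \<open>w\<close>, so the norm at
  \<open>x\<close> is at most \<open>w\<close>; weak duality, applied to one pair of eigenbases,
  bounds \<open>w\<close> by the norm at \<open>y\<close>.\<close>

lemma minimal_if_certificate:
  assumes n: "0 < n" and A: "A \<in> carrier_mat n n" "hermitian_mat A"
    and x: "x \<in> carrier_vec n" and y: "y \<in> carrier_vec n"
  defines "M \<equiv> real_shifted A x"
  assumes large: "largest_eigenvalue M w" and small: "smallest_eigenvalue M (- w)"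
    and cert: "\<And>Q\<^sub>1 Q\<^sub>2. orthonormal_eigenbasis M w Q\<^sub>1 \<Longrightarrow> orthonormal_eigenbasis M (- w) Q\<^sub>2 \<Longrightarrow>
      \<exists>U V. psd_mat (eigen_multiplicity M w) U \<and> psd_mat (eigen_multiplicity M (- w)) V \<and>
        mat_trace U + mat_trace V = 1 \<and>
        (\<forall>k<n. mat_trace (transpose_mat Q\<^sub>1 * pair_proj n k * Q\<^sub>1 * U)
           - mat_trace (transpose_mat Q\<^sub>2 * pair_proj n k * Q\<^sub>2 * V) = 0)"
  shows "spectral_norm M \<le> spectral_norm (real_shifted A y)"
proof -
  define N where "N = 2 * n"
  have M: "M \<in> carrier_mat N N" "transpose_mat M = M"
    unfolding M_def N_def by (rule real_shifted_carrier[OF A(1) x] real_shifted_symmetric[OF A(2,1) x])+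
  obtain a v where a: "\<bar>a\<bar> = spectral_norm M" "v \<in> carrier_vec N" "v \<noteq> 0\<^sub>v N" "M *\<^sub>v v = a \<cdot>\<^sub>v v"
    using symmetric_norm_attained[OF M] n by (auto simp: N_def)
  hence "eigenvalue M a"
    using M by (auto simp: eigenvalue_def eigenvector_def)
  hence "a \<le> w" "- w \<le> a"
    using large small by (auto simp: largest_eigenvalue_def smallest_eigenvalue_def)
  hence "spectral_norm M \<le> w"
    unfolding a(1)[symmetric] by (simp add: abs_le_iff)
  also have "w \<le> spectral_norm (real_shifted A y)"
  proof -
    obtain Q\<^sub>1 Q\<^sub>2 where Q: "orthonormal_eigenbasis M w Q\<^sub>1" "orthonormal_eigenbasis M (- w) Q\<^sub>2"
      using orthonormal_eigenbasis_exists[OF M] by metis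
    define t s where "t = eigen_multiplicity M w" and "s = eigen_multiplicity M (- w)"
    have Q1: "Q\<^sub>1 \<in> carrier_mat N t" "transpose_mat Q\<^sub>1 * Q\<^sub>1 = 1\<^sub>m t"
        "vec_space.col_space N Q\<^sub>1 = eigenspace M w"
      and Q2: "Q\<^sub>2 \<in> carrier_mat N s" "transpose_mat Q\<^sub>2 * Q\<^sub>2 = 1\<^sub>m s"
        "vec_space.col_space N Q\<^sub>2 = eigenspace M (- w)"
      using Q M by (auto simp: orthonormal_eigenbasis_def t_def s_def)
    obtain U V where UV: "psd_mat t U" "psd_mat s V" "mat_trace U + mat_trace V = 1"
      and bal: "\<And>k. k < n \<Longrightarrow> mat_trace (transpose_mat Q\<^sub>1 * pair_proj n k * Q\<^sub>1 * U)
           - mat_trace (transpose_mat Q\<^sub>2 * pair_proj n k * Q\<^sub>2 * V) = 0"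
      using cert[OF Q] unfolding t_def s_def by blast
    obtain G where G: "G \<in> carrier_mat t t" "U = G * transpose_mat G"
      using psd_mat_gram[OF UV(1)] by blast
    obtain H where H: "H \<in> carrier_mat s s" "V = H * transpose_mat H"
      using psd_mat_gram[OF UV(2)] by blast
    have E: "pair_proj n k \<in> carrier_mat N N" for k
      unfolding N_def by (rule pair_proj_carrier)
    have eig: "col (Q * F) r \<in> carrier_vec N \<and> M *\<^sub>v col (Q * F) r = b \<cdot>\<^sub>v col (Q * F) r"
      if Q: "Q \<in> carrier_mat N m" "vec_space.col_space N Q = eigenspace M b"
        and F: "F \<in> carrier_mat m m" and r: "r < m" for Q F m b r
    proof -
      have "col (Q * F) r = Q *\<^sub>v col F r"
        by (rule col_mult2[OF Q(1) F r])
      moreover have "col F r \<in> carrier_vec m" using F col_dim[of F r] by simp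
      ultimately have "col (Q * F) r \<in> vec_space.col_space N Q"
        unfolding vec_space.col_space_eq[OF Q(1)] using Q(1) by auto
      thus ?thesis
        unfolding Q(2) eigenspace_def using M by simp
    qed
    note e1 = eig[OF Q1(1,3) G(1)] and e2 = eig[OF Q2(1,3) H(1)]
    show ?thesis
    proof (rule certificate_le_spectral_norm[OF A(1) x y, where s = t and t = s
          and f = "col (Q\<^sub>1 * G)" and g = "col (Q\<^sub>2 * H)"])
      show "col (Q\<^sub>1 * G) r \<in> carrier_vec (2 * n)" "real_shifted A x *\<^sub>v col (Q\<^sub>1 * G) r = w \<cdot>\<^sub>v col (Q\<^sub>1 * G) r"
        if "r < t" for r
        using e1[OF that] by (auto simp: N_def M_def)
      show "col (Q\<^sub>2 * H) r \<in> carrier_vec (2 * n)" "real_shifted A x *\<^sub>v col (Q\<^sub>2 * H) r = (- w) \<cdot>\<^sub>v col (Q\<^sub>2 * H) r"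
        if "r < s" for r
        using e2[OF that] by (auto simp: N_def M_def)
      show "(\<Sum>r<t. col (Q\<^sub>1 * G) r \<bullet> col (Q\<^sub>1 * G) r) + (\<Sum>r<s. col (Q\<^sub>2 * H) r \<bullet> col (Q\<^sub>2 * H) r) = 1"
        unfolding mat_trace_gram_orthonormal[OF Q1(1,2) G(1), symmetric]
          mat_trace_gram_orthonormal[OF Q2(1,2) H(1), symmetric] G(2)[symmetric] H(2)[symmetric]
        by (rule UV(3))
      show "(\<Sum>r<t. col (Q\<^sub>1 * G) r \<bullet> (pair_proj n k *\<^sub>v col (Q\<^sub>1 * G) r))
        = (\<Sum>r<s. col (Q\<^sub>2 * H) r \<bullet> (pair_proj n k *\<^sub>v col (Q\<^sub>2 * H) r))" if "k < n" for k
        unfolding mat_trace_gram[OF Q1(1) G(1) E, symmetric] mat_trace_gram[OF Q2(1) H(1) E, symmetric]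
          G(2)[symmetric] H(2)[symmetric]
        using bal[OF that] by simp
    qed
  qed
  finally show ?thesis .
qed

theorem theorem1:
  fixes n :: nat and A\<^sub>0 :: "complex Matrix.mat" and x :: "real Matrix.vec"
  assumes "n \<ge> 1"
    and "A\<^sub>0 \<in> carrier_mat n n"
    and "hermitian_mat A\<^sub>0"
    and "x \<in> carrier_vec n"
  defines "cond1 \<equiv> is_arg_min (\<lambda>y. spectral_radius (shifted A\<^sub>0 y)) (\<lambda>y. y \<in> carrier_vec n) x"
    and "cond2 \<equiv> \<forall>y \<in> carrier_vec n.
           spectral_norm (real_shifted A\<^sub>0 x) \<le> spectral_norm (real_shifted A\<^sub>0 y)"
    and "cond3 \<equiv> \<exists>w \<ge> 0.
           largest_eigenvalue (real_shifted A\<^sub>0 x) w \<and>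
           smallest_eigenvalue (real_shifted A\<^sub>0 x) (- w) \<and>
           (\<forall>Q\<^sub>1 Q\<^sub>2.
              orthonormal_eigenbasis (real_shifted A\<^sub>0 x) w Q\<^sub>1 \<and>
              orthonormal_eigenbasis (real_shifted A\<^sub>0 x) (- w) Q\<^sub>2 \<longrightarrow>
              (\<exists>U V.
                 psd_mat (eigen_multiplicity (real_shifted A\<^sub>0 x) w) U \<and>
                 psd_mat (eigen_multiplicity (real_shifted A\<^sub>0 x) (- w)) V \<and>
                 mat_trace U + mat_trace V = 1 \<and>
                 (\<forall>k < n.
                    mat_trace (transpose_mat Q\<^sub>1 *
                      (unit_proj (2 * n) k + unit_proj (2 * n) (n + k)) * Q\<^sub>1 * U)
                  - mat_trace (transpose_mat Q\<^sub>2 *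
                      (unit_proj (2 * n) k + unit_proj (2 * n) (n + k)) * Q\<^sub>2 * V) = 0)))"
  shows "(cond1 \<longleftrightarrow> minimal_at A\<^sub>0 n x) \<and> (cond1 \<longleftrightarrow> cond2) \<and> (cond2 \<longleftrightarrow> cond3)"
proof -
  have n: "0 < n" using assms(1) by simp
  note A = assms(2,3) and x = assms(4)
  have radius: "spectral_radius (shifted A\<^sub>0 y) = spectral_norm (shifted A\<^sub>0 y)"
    if "y \<in> carrier_vec n" for y
    by (rule spectral_radius_eq_spectral_norm[OF shifted_carrier[OF A(1) that] n])
       (rule shifted_hermitian[OF A(2,1) that])
  have norm: "spectral_norm (real_shifted A\<^sub>0 y) = spectral_norm (shifted A\<^sub>0 y)"
    if "y \<in> carrier_vec n" for y
    unfolding real_shifted_eq_real_rep[OF A(1) that]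
    by (rule spectral_norm_real_rep[OF shifted_carrier[OF A(1) that]])
  have 1: "cond1 \<longleftrightarrow> minimal_at A\<^sub>0 n x"
    unfolding cond1_def is_arg_min_def minimal_at_def using x by (auto simp: radius not_less)
  have 2: "minimal_at A\<^sub>0 n x \<longleftrightarrow> cond2"
    unfolding cond2_def minimal_at_def using x by (simp add: norm)
  \<comment> \<open>The witness for \<open>w\<close> is the spectral norm at
    \<open>x\<close>.\<close>
  have 3: "cond2 \<Longrightarrow> cond3"
    unfolding cond2_def cond3_def
    using certificate_if_minimal[OF n A x, unfolded pair_proj_def] spectral_norm_nonneg by blast
  have 4: "cond3 \<Longrightarrow> cond2"
    unfolding cond2_def cond3_def
    using minimal_if_certificate[OF n A x, unfolded pair_proj_def] by blast
  show ?thesis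
    using 1 2 3 4 by blast
qed

end
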